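(* Let $r>1$. Let $J$ be a quantum annulus unitary on a complex Hilbert space $\mathcal{H}$ with $\|J\|=\|J^{-1}\|=r$, and let $A,B$ be bounded operators (not necessarily commuting) on a complex Hilbert space $\mathcal{L}$. Then $A\otimes J+B\otimes J^{-*}$ is an isometry (on $\mathcal{L}\otimes\mathcal{H}$) if and only if $A^*A=B^*B$ and $A^*B+B^*A+(r^2+r^{-2})A^*A=I$.
   Context: An invertible bounded operator $J$ on a complex Hilbert space is a quantum annulus unitary if $(r^2+r^{-2})I-J^*J-(J^*J)^{-1}=0$. For an invertible operator $J$, $J^{-*}=(J^{-1})^*$. Tensor products are Hilbert space tensor products. *)

theory Defs
  imports "HOL-Analysis.Analysis"
begin

section \<open>Complex Hilbert spaces\<close>

class complex_vector = real_vector +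
  fixes scaleC :: "complex \<Rightarrow> 'a \<Rightarrow> 'a" (infixr "*\<^sub>C" 75)
  assumes scaleC_add_right: "c *\<^sub>C (x + y) = c *\<^sub>C x + c *\<^sub>C y"
    and scaleC_add_left: "(c + d) *\<^sub>C x = c *\<^sub>C x + d *\<^sub>C x"
    and scaleC_scaleC [simp]: "c *\<^sub>C d *\<^sub>C x = (c * d) *\<^sub>C x"
    and scaleC_one [simp]: "1 *\<^sub>C x = x"
    and scaleR_scaleC: "r *\<^sub>R x = complex_of_real r *\<^sub>C x"

text \<open>The inner product is linear in the first and conjugate-linear in the second argument.\<close>

class complex_inner = complex_vector + real_normed_vector +
  fixes cinner :: "'a \<Rightarrow> 'a \<Rightarrow> complex"
  assumes cinner_commute: "cinner x y = cnj (cinner y x)"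
    and cinner_add_left: "cinner (x + y) z = cinner x z + cinner y z"
    and cinner_scaleC_left [simp]: "cinner (c *\<^sub>C x) y = c * cinner x y"
    and cinner_ge_zero: "0 \<le> Re (cinner x x)"
    and cinner_eq_zero_iff [simp]: "cinner x x = 0 \<longleftrightarrow> x = 0"
    and norm_eq_sqrt_cinner: "norm x = sqrt (Re (cinner x x))"

class complex_hilbert_space = complex_inner + complete_space

lemma cinner_add_right: "cinner x (y + z) = cinner x y + cinner x (z::'a::complex_inner)"
  by (metis cinner_add_left cinner_commute complex_cnj_add)

lemma cinner_scaleC_right [simp]: "cinner x (c *\<^sub>C y) = cnj c * cinner x (y::'a::complex_inner)"
  by (metis cinner_commute cinner_scaleC_left complex_cnj_mult)

lemma cinner_scaleR_left [simp]: "cinner (r *\<^sub>R x) y = of_real r * cinner x (y::'a::complex_inner)"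
  by (simp add: scaleR_scaleC)

lemma cinner_zero_left [simp]: "cinner 0 (y::'a::complex_inner) = 0"
  using cinner_add_left[of 0 0 y] by simp

lemma cinner_minus_left [simp]: "cinner (- x) y = - cinner x (y::'a::complex_inner)"
  using cinner_add_left[of x "- x" y] by (simp add: eq_neg_iff_add_eq_0 add.commute)

lemma cinner_diff_left: "cinner (x - y) z = cinner x z - cinner y (z::'a::complex_inner)"
  using cinner_add_left[of x "- y" z] by simp

lemma cinner_zero_right [simp]: "cinner (y::'a::complex_inner) 0 = 0"
  using cinner_add_right[of y 0 0] by simp

lemma cinner_minus_right [simp]: "cinner x (- y) = - cinner x (y::'a::complex_inner)"
  by (metis cinner_commute cinner_minus_left complex_cnj_minus)

lemma cinner_diff_right: "cinner x (y - z) = cinner x y - cinner x (z::'a::complex_inner)"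
  using cinner_add_right[of x y "- z"] by simp

lemma cinner_self: "cinner x x = complex_of_real ((norm (x::'a::complex_inner))\<^sup>2)"
proof -
  have "Im (cinner x x) = 0"
    using cinner_commute[of x x] by (metis Reals_cnj_iff complex_is_Real_iff)
  then show ?thesis
    by (simp add: norm_eq_sqrt_cinner cinner_ge_zero complex_eq_iff)
qed

lemma norm_scaleC [simp]: "norm (c *\<^sub>C x) = cmod c * norm (x::'a::complex_inner)"
proof -
  have "cinner (c *\<^sub>C x) (c *\<^sub>C x) = (c * cnj c) * cinner x x"
    by (simp add: mult.assoc)
  also have "\<dots> = complex_of_real ((cmod c)\<^sup>2 * (norm x)\<^sup>2)"
    by (simp only: cinner_self of_real_mult complex_norm_square)
  finally show ?thesis
    by (simp add: norm_eq_sqrt_cinner[of "c *\<^sub>C x"] real_sqrt_mult)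
qed

lemma cinner_sum_left: "cinner (\<Sum>i\<in>I. f i) y = (\<Sum>i\<in>I. cinner (f i) (y::'a::complex_inner))"
  by (induction I rule: infinite_finite_induct) (auto simp: cinner_add_left)

lemma cinner_sum_right: "cinner y (\<Sum>i\<in>I. f i) = (\<Sum>i\<in>I. cinner (y::'a::complex_inner) (f i))"
  by (induction I rule: infinite_finite_induct) (auto simp: cinner_add_right)

text \<open>
  Stated for a bare form, so that it also serves for the semidefinite form on formal sums below.
\<close>

lemma semi_Cauchy_Schwarz:
  fixes a b :: real and s :: complex
  assumes b: "0 \<le> b"
    and "\<And>c. 0 \<le> a + Re (cnj c * s) + Re (c * cnj s) + (cmod c)\<^sup>2 * b"
  shows "(cmod s)\<^sup>2 \<le> a * b"
proof -
  have *: "0 \<le> a + 2 * t * (cmod s)\<^sup>2 + t\<^sup>2 * (cmod s)\<^sup>2 * b" for t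
  proof -
    have "Re (cnj (t *\<^sub>R s) * s) = t * (cmod s)\<^sup>2" "Re ((t *\<^sub>R s) * cnj s) = t * (cmod s)\<^sup>2"
      by (simp_all only: cmod_power2) (simp_all add: algebra_simps power2_eq_square)
    then show ?thesis using assms(2)[of "t *\<^sub>R s"]
      by (simp only: norm_scaleR power_mult_distrib power2_abs)
  qed
  have a: "0 \<le> a" using *[of 0] by simp
  show ?thesis
  proof (cases "b = 0")
    case True
    have "s = 0"
    proof (rule ccontr)
      assume "s \<noteq> 0"
      then have "- (a + 1) / (cmod s)\<^sup>2 * (cmod s)\<^sup>2 = - (a + 1)" by simp
      then show False using *[of "- (a + 1) / (cmod s)\<^sup>2"] True a
        by (simp only: mult.assoc) simp
    qed
    then show ?thesis using a b by simp
  next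
    case False
    then have b: "b > 0" using b by simp
    have "0 \<le> a - (cmod s)\<^sup>2 / b"
      using *[of "- 1 / b"] b by (simp add: power2_eq_square field_simps)
    then show ?thesis using b by (simp add: field_simps)
  qed
qed

lemma Cauchy_Schwarz_cinner: "cmod (cinner x y) \<le> norm x * norm (y::'a::complex_inner)"
proof -
  have "0 \<le> (norm x)\<^sup>2 + Re (cnj c * cinner x y) + Re (c * cnj (cinner x y)) + (cmod c)\<^sup>2 * (norm y)\<^sup>2" for c
  proof -
    have "cinner (x + c *\<^sub>C y) (x + c *\<^sub>C y)
        = cinner x x + cnj c * cinner x y + c * cnj (cinner x y) + (c * cnj c) * cinner y y"
      using cinner_commute[of y x]
      by (simp add: cinner_add_left cinner_add_right algebra_simps)
    also have "Re \<dots> = (norm x)\<^sup>2 + Re (cnj c * cinner x y) + Re (c * cnj (cinner x y)) + (cmod c)\<^sup>2 * (norm y)\<^sup>2"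
      by (simp add: cinner_self complex_norm_square[symmetric] flip: of_real_mult of_real_power)
    finally show ?thesis using cinner_ge_zero[of "x + c *\<^sub>C y"] by simp
  qed
  then have "(cmod (cinner x y))\<^sup>2 \<le> (norm x)\<^sup>2 * (norm y)\<^sup>2" by (intro semi_Cauchy_Schwarz) auto
  then have "(cmod (cinner x y))\<^sup>2 \<le> (norm x * norm y)\<^sup>2" by (simp add: power_mult_distrib)
  then show ?thesis by (rule power2_le_imp_le) simp
qed


section \<open>Completion of an inner product space\<close>

definition null_rel :: "(nat \<Rightarrow> 'a::real_normed_vector) \<Rightarrow> (nat \<Rightarrow> 'a) \<Rightarrow> bool" where
  "null_rel X Y \<longleftrightarrow> Cauchy X \<and> Cauchy Y \<and> (\<lambda>n. X n - Y n) \<longlonglongrightarrow> 0"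

lemma part_equivp_null_rel: "part_equivp (null_rel :: (nat \<Rightarrow> 'a::real_normed_vector) \<Rightarrow> _)"
proof (rule part_equivpI)
  show "\<exists>x::nat \<Rightarrow> 'a. null_rel x x"
    by (rule exI[of _ "\<lambda>_. 0"]) (auto simp: null_rel_def intro: LIMSEQ_imp_Cauchy)
  show "symp (null_rel :: (nat \<Rightarrow> 'a) \<Rightarrow> _)"
    by (rule sympI) (auto simp: null_rel_def dest: tendsto_minus)
  show "transp (null_rel :: (nat \<Rightarrow> 'a) \<Rightarrow> _)"
  proof (rule transpI)
    fix X Y Z :: "nat \<Rightarrow> 'a"
    assume "null_rel X Y" "null_rel Y Z"
    then show "null_rel X Z"
      using tendsto_add[of "\<lambda>n. X n - Y n" 0 sequentially "\<lambda>n. Y n - Z n" 0]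
      by (auto simp: null_rel_def)
  qed
qed

quotient_type (overloaded) 'a completion = "nat \<Rightarrow> 'a::complex_inner" / partial: null_rel
  by (rule part_equivp_null_rel)

lemma Cauchy_add_seq:
  fixes X Y :: "nat \<Rightarrow> 'a::real_normed_vector"
  assumes "Cauchy X" "Cauchy Y"
  shows "Cauchy (\<lambda>n. X n + Y n)"
proof (rule CauchyI)
  fix e :: real assume "0 < e"
  then obtain M N where M: "\<And>m n. m \<ge> M \<Longrightarrow> n \<ge> M \<Longrightarrow> norm (X m - X n) < e / 2"
    and N: "\<And>m n. m \<ge> N \<Longrightarrow> n \<ge> N \<Longrightarrow> norm (Y m - Y n) < e / 2"
    using assms by (meson CauchyD half_gt_zero)
  have "norm (X m + Y m - (X n + Y n)) < e" if "m \<ge> max M N" "n \<ge> max M N" for m n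
    using norm_triangle_ineq[of "X m - X n" "Y m - Y n"] M[of m n] N[of m n] that
    by (simp add: algebra_simps)
  then show "\<exists>M. \<forall>m\<ge>M. \<forall>n\<ge>M. norm (X m + Y m - (X n + Y n)) < e" by blast
qed

lemma bounded_linear_scaleC: "bounded_linear (\<lambda>x::'a::complex_inner. c *\<^sub>C x)"
  by (rule bounded_linear_intro[where K = "cmod c"])
     (auto simp: scaleC_add_right scaleR_scaleC mult.commute)

lemma Cauchy_norm_bounded:
  assumes "Cauchy (X :: nat \<Rightarrow> 'a::real_normed_vector)"
  obtains K where "K > 0" "\<And>n. norm (X n) \<le> K"
  using Cauchy_Bseq[OF assms] by (auto elim: BseqE)

lemma null_times_bounded:
  fixes X Y :: "nat \<Rightarrow> 'a::complex_inner"
  assumes "X \<longlonglongrightarrow> 0" "Cauchy Y"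
  shows "(\<lambda>n. cinner (X n) (Y n)) \<longlonglongrightarrow> 0" "(\<lambda>n. cinner (Y n) (X n)) \<longlonglongrightarrow> 0"
proof -
  obtain K where K: "\<And>n. norm (Y n) \<le> K" using Cauchy_norm_bounded[OF assms(2)] by blast
  have 0: "(\<lambda>n. norm (X n) * K) \<longlonglongrightarrow> 0"
    using tendsto_mult_right[OF tendsto_norm_zero[OF assms(1)], of K] by simp
  have 1: "cmod (cinner (X n) (Y n)) \<le> norm (X n) * K" for n
    using Cauchy_Schwarz_cinner[of "X n" "Y n"] mult_left_mono[OF K[of n], of "norm (X n)"] by simp
  then have 2: "cmod (cinner (Y n) (X n)) \<le> norm (X n) * K" for n
    by (metis cinner_commute complex_mod_cnj)
  show "(\<lambda>n. cinner (X n) (Y n)) \<longlonglongrightarrow> 0" "(\<lambda>n. cinner (Y n) (X n)) \<longlonglongrightarrow> 0"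
    by (rule Lim_null_comparison[OF _ 0]; use 1 2 in simp)+
qed

lemma Cauchy_cinner:
  fixes X Y :: "nat \<Rightarrow> 'a::complex_inner"
  assumes "Cauchy X" "Cauchy Y"
  shows "Cauchy (\<lambda>n. cinner (X n) (Y n))"
proof (rule CauchyI)
  fix e :: real assume e: "0 < e"
  obtain K L where K: "K > 0" "\<And>n. norm (X n) \<le> K" and L: "L > 0" "\<And>n. norm (Y n) \<le> L"
    using Cauchy_norm_bounded assms by metis
  define d where "d = e / (K + L)"
  have d: "d > 0" using e K L by (simp add: d_def)
  obtain M N where M: "\<And>m n. m \<ge> M \<Longrightarrow> n \<ge> M \<Longrightarrow> norm (X m - X n) < d"
    and N: "\<And>m n. m \<ge> N \<Longrightarrow> n \<ge> N \<Longrightarrow> norm (Y m - Y n) < d"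
    using assms d by (meson CauchyD)
  have "norm (cinner (X m) (Y m) - cinner (X n) (Y n)) < e" if "m \<ge> max M N" "n \<ge> max M N" for m n
  proof -
    have "cinner (X m) (Y m) - cinner (X n) (Y n)
        = cinner (X m - X n) (Y m) + cinner (X n) (Y m - Y n)"
      by (simp add: cinner_diff_left cinner_diff_right)
    also have "norm \<dots> \<le> norm (X m - X n) * norm (Y m) + norm (X n) * norm (Y m - Y n)"
      by (intro norm_triangle_le add_mono Cauchy_Schwarz_cinner)
    also have "\<dots> \<le> norm (X m - X n) * L + K * norm (Y m - Y n)"
      by (intro add_mono mult_left_mono mult_right_mono K L) auto
    also have "\<dots> < d * L + K * d"
      using M[of m n] N[of m n] that K L
      by (intro add_strict_mono mult_strict_right_mono mult_strict_left_mono) auto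
    also have "\<dots> = d * (K + L)" by (simp add: algebra_simps)
    also have "\<dots> = e" using K L by (simp add: d_def)
    finally show ?thesis .
  qed
  then show "\<exists>M. \<forall>m\<ge>M. \<forall>n\<ge>M. norm (cinner (X m) (Y m) - cinner (X n) (Y n)) < e" by blast
qed

lemma Cauchy_tendsto_lim: "Cauchy X \<Longrightarrow> X \<longlonglongrightarrow> lim (X :: nat \<Rightarrow> 'a::banach)"
  using Cauchy_convergent convergent_LIMSEQ_iff by blast

lemma Cauchy_norm_seq: "Cauchy X \<Longrightarrow> Cauchy (\<lambda>n. norm (X n :: 'a::real_normed_vector))"
  unfolding Cauchy_iff by (metis norm_triangle_ineq3 order_le_less_trans real_norm_def)

lemma lim_eq_of_diff:
  fixes X Y :: "nat \<Rightarrow> 'a::banach"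
  assumes "Cauchy X" "Cauchy Y" "(\<lambda>n. X n - Y n) \<longlonglongrightarrow> 0"
  shows "lim X = lim Y"
  using tendsto_diff[OF Cauchy_tendsto_lim[OF assms(1)] Cauchy_tendsto_lim[OF assms(2)]] assms(3)
    LIMSEQ_unique by fastforce

lemma Cauchy_scaleC: "Cauchy X \<Longrightarrow> Cauchy (\<lambda>n. c *\<^sub>C (X n :: 'a::complex_inner))"
  by (rule bounded_linear.Cauchy[OF bounded_linear_scaleC])

lemma null_rel_self [simp]: "null_rel X X \<longleftrightarrow> Cauchy X"
  by (simp add: null_rel_def)

lemma scaleC_zero_left [simp]: "0 *\<^sub>C x = (0::'a::complex_vector)"
  using scaleR_scaleC[of 0 x] by simp

lemma scaleC_minus_one: "(- 1) *\<^sub>C x = - (x::'a::complex_vector)"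
  using scaleR_scaleC[of "-1" x] by simp

instantiation completion :: (complex_inner) complex_inner
begin

lift_definition zero_completion :: "'a completion" is "\<lambda>_. 0"
  by (auto simp: null_rel_def intro: LIMSEQ_imp_Cauchy)

lift_definition plus_completion :: "'a completion \<Rightarrow> 'a completion \<Rightarrow> 'a completion"
  is "\<lambda>X Y n. X n + Y n"
proof -
  fix X X' Y Y' :: "nat \<Rightarrow> 'a"
  assume "null_rel X X'" "null_rel Y Y'"
  then show "null_rel (\<lambda>n. X n + Y n) (\<lambda>n. X' n + Y' n)"
    using tendsto_add[of "\<lambda>n. X n - X' n" 0 sequentially "\<lambda>n. Y n - Y' n" 0]
    by (auto simp: null_rel_def Cauchy_add_seq algebra_simps)
qed

lift_definition scaleC_completion :: "complex \<Rightarrow> 'a completion \<Rightarrow> 'a completion"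
  is "\<lambda>c X n. c *\<^sub>C X n"
proof -
  fix c :: complex and X X' :: "nat \<Rightarrow> 'a"
  assume X: "null_rel X X'"
  interpret bounded_linear "\<lambda>x::'a. c *\<^sub>C x" by (rule bounded_linear_scaleC)
  show "null_rel (\<lambda>n. c *\<^sub>C X n) (\<lambda>n. c *\<^sub>C X' n)"
    using X tendsto_zero[of "\<lambda>n. X n - X' n"] by (auto simp: null_rel_def Cauchy diff)
qed

definition uminus_completion :: "'a completion \<Rightarrow> 'a completion" where
  "uminus_completion x = (- 1) *\<^sub>C x"

definition minus_completion :: "'a completion \<Rightarrow> 'a completion \<Rightarrow> 'a completion" where
  "minus_completion x y = x + (- y)"

definition scaleR_completion :: "real \<Rightarrow> 'a completion \<Rightarrow> 'a completion" where
  "scaleR_completion r x = complex_of_real r *\<^sub>C x"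

lift_definition cinner_completion :: "'a completion \<Rightarrow> 'a completion \<Rightarrow> complex"
  is "\<lambda>X Y. lim (\<lambda>n. cinner (X n) (Y n))"
proof -
  fix X X' Y Y' :: "nat \<Rightarrow> 'a"
  assume *: "null_rel X X'" "null_rel Y Y'"
  have "(\<lambda>n. cinner (X n) (Y n) - cinner (X' n) (Y' n)) \<longlonglongrightarrow> 0"
    using tendsto_add[OF null_times_bounded(1)[of "\<lambda>n. X n - X' n" Y]
        null_times_bounded(2)[of "\<lambda>n. Y n - Y' n" X']] *
    by (simp add: null_rel_def cinner_diff_left cinner_diff_right)
  then show "lim (\<lambda>n. cinner (X n) (Y n)) = lim (\<lambda>n. cinner (X' n) (Y' n))"
    using * by (intro lim_eq_of_diff Cauchy_cinner) (auto simp: null_rel_def)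
qed

lift_definition norm_completion :: "'a completion \<Rightarrow> real" is "\<lambda>X. lim (\<lambda>n. norm (X n))"
proof -
  fix X Y :: "nat \<Rightarrow> 'a"
  assume *: "null_rel X Y"
  have "(\<lambda>n. norm (X n) - norm (Y n)) \<longlonglongrightarrow> 0"
    by (rule Lim_null_comparison[where g = "\<lambda>n. norm (X n - Y n)"])
       (use * in \<open>auto simp: null_rel_def tendsto_norm_zero intro!: always_eventually norm_triangle_ineq3\<close>)
  then show "lim (\<lambda>n. norm (X n)) = lim (\<lambda>n. norm (Y n))"
    using * by (intro lim_eq_of_diff Cauchy_norm_seq) (auto simp: null_rel_def)
qed

definition dist_completion :: "'a completion \<Rightarrow> 'a completion \<Rightarrow> real" where
  "dist_completion x y = norm (x - y)"

definition sgn_completion :: "'a completion \<Rightarrow> 'a completion" where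
  "sgn_completion x = scaleR (inverse (norm x)) x"

definition [code del]:
  "(uniformity :: ('a completion \<times> 'a completion) filter)
    = (INF e\<in>{0 <..}. principal {(x, y). dist x y < e})"

definition open_completion :: "'a completion set \<Rightarrow> bool" where
  "open_completion U \<longleftrightarrow> (\<forall>x\<in>U. eventually (\<lambda>(x', y). x' = x \<longrightarrow> y \<in> U) uniformity)"

instance
proof
  fix x y z :: "'a completion" and c d :: complex and a b r :: real
  have C_const: "Cauchy (\<lambda>_. v)" for v :: 'a
    by (auto intro: LIMSEQ_imp_Cauchy)
  have add_right: "c *\<^sub>C (x + y) = c *\<^sub>C x + c *\<^sub>C y" for c and x y :: "'a completion"
    by transfer (simp add: scaleC_add_right Cauchy_add_seq Cauchy_scaleC)
  have add_left: "(c + d) *\<^sub>C x = c *\<^sub>C x + d *\<^sub>C x" for c d and x :: "'a completion"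
    by transfer (simp add: scaleC_add_left Cauchy_add_seq Cauchy_scaleC)
  have assoc: "c *\<^sub>C d *\<^sub>C x = (c * d) *\<^sub>C x" for c d and x :: "'a completion"
    by transfer (simp add: Cauchy_scaleC)
  have one: "1 *\<^sub>C x = x" for x :: "'a completion"
    by transfer simp
  have zero: "0 *\<^sub>C x = 0" for x :: "'a completion"
    by transfer (simp add: C_const)
  show "x + y + z = x + (y + z)"
    by transfer (simp add: Cauchy_add_seq add.assoc)
  show "x + y = y + x"
    by transfer (simp add: Cauchy_add_seq add.commute)
  show "0 + x = x"
    by transfer simp
  show "- x + x = 0"
    using add_left[of "-1" 1 x] by (simp add: uminus_completion_def one zero)
  show "x - y = x + - y"
    by (rule minus_completion_def)
  show "a *\<^sub>R (x + y) = a *\<^sub>R x + a *\<^sub>R y" "(a + b) *\<^sub>R x = a *\<^sub>R x + b *\<^sub>R x"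
    "a *\<^sub>R b *\<^sub>R x = (a * b) *\<^sub>R x" "1 *\<^sub>R x = x" "r *\<^sub>R x = complex_of_real r *\<^sub>C x"
    by (simp_all add: scaleR_completion_def add_right add_left assoc one)
  show "c *\<^sub>C (x + y) = c *\<^sub>C x + c *\<^sub>C y" "(c + d) *\<^sub>C x = c *\<^sub>C x + d *\<^sub>C x"
    "c *\<^sub>C d *\<^sub>C x = (c * d) *\<^sub>C x" "1 *\<^sub>C x = x"
    by (fact add_right add_left assoc one)+
  show "dist x y = norm (x - y)" by (rule dist_completion_def)
  show "sgn x = scaleR (inverse (norm x)) x" by (rule sgn_completion_def)
  show "(uniformity :: ('a completion \<times> 'a completion) filter)
    = (INF e\<in>{0 <..}. principal {(x, y). dist x y < e})"
    by (rule uniformity_completion_def)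
  show "open U \<longleftrightarrow> (\<forall>x\<in>U. \<forall>\<^sub>F (x', y) in uniformity. x' = x \<longrightarrow> y \<in> U)" for U :: "'a completion set"
    by (rule open_completion_def)
  show norm_0: "norm x = 0 \<longleftrightarrow> x = 0" for x :: "'a completion"
  proof transfer
    fix X :: "nat \<Rightarrow> 'a"
    assume "null_rel X X"
    then have *: "(\<lambda>n. norm (X n)) \<longlonglongrightarrow> lim (\<lambda>n. norm (X n))" and X: "Cauchy X"
      by (simp_all add: Cauchy_norm_seq Cauchy_tendsto_lim)
    have "lim (\<lambda>n. norm (X n)) = 0 \<longleftrightarrow> (\<lambda>n. norm (X n)) \<longlonglongrightarrow> 0"
      using * limI by metis
    then show "lim (\<lambda>n. norm (X n)) = 0 \<longleftrightarrow> null_rel X (\<lambda>_. 0)"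
      using X by (simp add: null_rel_def C_const tendsto_norm_zero_iff)
  qed
  show "norm (x + y) \<le> norm x + norm y"
  proof transfer
    fix X Y :: "nat \<Rightarrow> 'a"
    assume "null_rel X X" "null_rel Y Y"
    then have "(\<lambda>n. norm (X n + Y n)) \<longlonglongrightarrow> lim (\<lambda>n. norm (X n + Y n))"
      "(\<lambda>n. norm (X n) + norm (Y n)) \<longlonglongrightarrow> lim (\<lambda>n. norm (X n)) + lim (\<lambda>n. norm (Y n))"
      by (auto intro!: tendsto_add Cauchy_tendsto_lim Cauchy_norm_seq Cauchy_add_seq)
    then show "lim (\<lambda>n. norm (X n + Y n)) \<le> lim (\<lambda>n. norm (X n)) + lim (\<lambda>n. norm (Y n))"
      by (rule LIMSEQ_le) (auto intro: norm_triangle_ineq)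
  qed
  show "norm (a *\<^sub>R x) = \<bar>a\<bar> * norm x"
    unfolding scaleR_completion_def
  proof transfer
    fix a and X :: "nat \<Rightarrow> 'a"
    assume "null_rel X X"
    then have "(\<lambda>n. \<bar>a\<bar> * norm (X n)) \<longlonglongrightarrow> \<bar>a\<bar> * lim (\<lambda>n. norm (X n))"
      by (auto intro!: tendsto_mult_left Cauchy_tendsto_lim Cauchy_norm_seq)
    then show "lim (\<lambda>n. norm (complex_of_real a *\<^sub>C X n)) = \<bar>a\<bar> * lim (\<lambda>n. norm (X n))"
      by (simp add: limI)
  qed
  have cinner_norm: "cinner x x = complex_of_real ((norm x)\<^sup>2)" for x :: "'a completion"
  proof transfer
    fix X :: "nat \<Rightarrow> 'a"
    assume "null_rel X X"
    then have "(\<lambda>n. complex_of_real ((norm (X n))\<^sup>2)) \<longlonglongrightarrow> complex_of_real ((lim (\<lambda>n. norm (X n)))\<^sup>2)"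
      by (intro tendsto_of_real tendsto_power Cauchy_tendsto_lim Cauchy_norm_seq) simp
    then show "lim (\<lambda>n. cinner (X n) (X n)) = complex_of_real ((lim (\<lambda>n. norm (X n)))\<^sup>2)"
      by (simp add: cinner_self limI)
  qed
  have norm_ge: "0 \<le> norm x" for x :: "'a completion"
  proof transfer
    fix X :: "nat \<Rightarrow> 'a"
    assume "null_rel X X"
    then show "0 \<le> lim (\<lambda>n. norm (X n))"
      by (intro LIMSEQ_le_const[OF Cauchy_tendsto_lim[OF Cauchy_norm_seq]]) auto
  qed
  show "cinner x y = cnj (cinner y x)"
  proof transfer
    fix X Y :: "nat \<Rightarrow> 'a"
    assume "null_rel X X" "null_rel Y Y"
    then have "(\<lambda>n. cnj (cinner (Y n) (X n))) \<longlonglongrightarrow> cnj (lim (\<lambda>n. cinner (Y n) (X n)))"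
      by (intro tendsto_cnj Cauchy_tendsto_lim Cauchy_cinner) auto
    then show "lim (\<lambda>n. cinner (X n) (Y n)) = cnj (lim (\<lambda>n. cinner (Y n) (X n)))"
      by (intro limI) (simp flip: cinner_commute)
  qed
  show "cinner (x + y) z = cinner x z + cinner y z"
  proof transfer
    fix X Y Z :: "nat \<Rightarrow> 'a"
    assume "null_rel X X" "null_rel Y Y" "null_rel Z Z"
    then have "(\<lambda>n. cinner (X n) (Z n) + cinner (Y n) (Z n))
        \<longlonglongrightarrow> lim (\<lambda>n. cinner (X n) (Z n)) + lim (\<lambda>n. cinner (Y n) (Z n))"
      by (intro tendsto_add Cauchy_tendsto_lim Cauchy_cinner) auto
    then show "lim (\<lambda>n. cinner (X n + Y n) (Z n))
        = lim (\<lambda>n. cinner (X n) (Z n)) + lim (\<lambda>n. cinner (Y n) (Z n))"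
      by (intro limI) (simp add: cinner_add_left)
  qed
  show "cinner (c *\<^sub>C x) y = c * cinner x y"
  proof transfer
    fix c and X Y :: "nat \<Rightarrow> 'a"
    assume "null_rel X X" "null_rel Y Y"
    then have "(\<lambda>n. c * cinner (X n) (Y n)) \<longlonglongrightarrow> c * lim (\<lambda>n. cinner (X n) (Y n))"
      by (intro tendsto_mult_left Cauchy_tendsto_lim Cauchy_cinner) auto
    then show "lim (\<lambda>n. cinner (c *\<^sub>C X n) (Y n)) = c * lim (\<lambda>n. cinner (X n) (Y n))"
      by (intro limI) simp
  qed
  show "0 \<le> Re (cinner x x)" "cinner x x = 0 \<longleftrightarrow> x = 0" "norm x = sqrt (Re (cinner x x))"
    by (simp_all add: cinner_norm norm_0 norm_ge del: of_real_power)
qed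

end

lift_definition to_completion :: "'a::complex_inner \<Rightarrow> 'a completion" is "\<lambda>x _. x"
  by (auto intro: LIMSEQ_imp_Cauchy)

lemma cinner_to_completion [simp]: "cinner (to_completion x) (to_completion y) = cinner x y"
  by transfer (simp add: limI)

lemma to_completion_add: "to_completion (x + y) = to_completion x + to_completion y"
  by transfer (auto intro: LIMSEQ_imp_Cauchy)

lemma to_completion_scaleC: "to_completion (c *\<^sub>C x) = c *\<^sub>C to_completion x"
  by transfer (auto intro: LIMSEQ_imp_Cauchy)

lemma to_completion_diff: "to_completion (x - y) = to_completion x - to_completion y"
  using to_completion_add[of x "- y"] to_completion_scaleC[of "-1" y] by (simp add: scaleC_minus_one)

lemma norm_to_completion [simp]: "norm (to_completion x) = norm x"
  by (simp add: norm_eq_sqrt_cinner)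

lemma to_completion_tendsto:
  assumes X: "Cauchy (X :: nat \<Rightarrow> 'a::complex_inner)"
  shows "(\<lambda>n. to_completion (X n)) \<longlonglongrightarrow> abs_completion X"
proof (rule LIMSEQ_I)
  fix e :: real assume e: "0 < e"
  then obtain M where M: "\<And>m n. m \<ge> M \<Longrightarrow> n \<ge> M \<Longrightarrow> norm (X m - X n) < e / 2"
    using CauchyD[OF X, of "e / 2"] by auto
  have "norm (to_completion (X n) - abs_completion X) \<le> e / 2" if n: "n \<ge> M" for n
  proof -
    have CX: "Cauchy (\<lambda>m. X n + (- 1) *\<^sub>C X m)"
      using X by (intro Cauchy_add_seq Cauchy_scaleC) (auto intro: LIMSEQ_imp_Cauchy)
    have "to_completion (X n) - abs_completion X = abs_completion (\<lambda>m. X n + (- 1) *\<^sub>C X m)"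
      unfolding minus_completion_def uminus_completion_def to_completion_def
      using X by (simp add: scaleC_completion.abs_eq plus_completion.abs_eq Cauchy_scaleC
          LIMSEQ_imp_Cauchy[OF tendsto_const])
    then have "norm (to_completion (X n) - abs_completion X) = lim (\<lambda>m. norm (X n - X m))"
      using CX by (simp add: norm_completion.abs_eq scaleC_minus_one)
    also have "\<dots> \<le> e / 2"
    proof (rule LIMSEQ_le_const2)
      show "(\<lambda>m. norm (X n - X m)) \<longlonglongrightarrow> lim (\<lambda>m. norm (X n - X m))"
        using CX by (intro Cauchy_tendsto_lim Cauchy_norm_seq) (simp add: scaleC_minus_one)
      show "\<exists>N. \<forall>m\<ge>N. norm (X n - X m) \<le> e / 2" using M n by (meson less_imp_le)
    qed
    finally show ?thesis .
  qed
  then show "\<exists>no. \<forall>n\<ge>no. norm (to_completion (X n) - abs_completion X) < e"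
    using e by (intro exI[of _ M]) (smt (verit) field_sum_of_halves)
qed

lemma to_completion_dense: "closure (range to_completion) = (UNIV :: 'a::complex_inner completion set)"
proof -
  have "F \<in> closure (range to_completion)" for F :: "'a completion"
  proof -
    obtain X where "Cauchy X" "F = abs_completion X"
      by (metis Quotient_completion Quotient_rel_rep Quotient_abs_rep null_rel_self)
    then show ?thesis using to_completion_tendsto
      unfolding closure_sequential by (intro exI[of _ "\<lambda>n. to_completion (X n)"]) auto
  qed
  then show ?thesis by blast
qed

instance completion :: (complex_inner) complex_hilbert_space
proof
  fix F :: "nat \<Rightarrow> 'a completion"
  assume F: "Cauchy F"
  have "\<exists>x. dist (to_completion x) (F n) < inverse (real (Suc n))" for n
    using to_completion_dense closure_approachable[of "F n" "range to_completion"] by auto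
  then obtain X where X: "\<And>n. dist (to_completion (X n)) (F n) < inverse (real (Suc n))"
    by metis
  have 0: "(\<lambda>n. to_completion (X n) - F n) \<longlonglongrightarrow> 0"
    by (rule Lim_null_comparison[OF _ LIMSEQ_inverse_real_of_nat])
       (use X in \<open>auto simp: dist_norm less_imp_le\<close>)
  have "Cauchy (\<lambda>n. (to_completion (X n) - F n) + F n)"
    by (intro Cauchy_add_seq LIMSEQ_imp_Cauchy[OF 0] F)
  then have "Cauchy X"
    by (simp add: Cauchy_iff flip: to_completion_diff)
  then have "(\<lambda>n. to_completion (X n) - (to_completion (X n) - F n)) \<longlonglongrightarrow> abs_completion X - 0"
    by (intro tendsto_diff 0 to_completion_tendsto)
  then show "convergent F" by (auto simp: convergent_def)
qed


section \<open>Hilbert space tensor product\<close>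

text \<open>
  A list \<open>[(x\<^sub>1, y\<^sub>1), \<dots>, (x\<^sub>n, y\<^sub>n)]\<close> stands for the formal sum \<open>x\<^sub>1 \<otimes> y\<^sub>1 + \<dots> + x\<^sub>n \<otimes> y\<^sub>n\<close>; scalars are
  absorbed into the first factors. The sesquilinear form induced by
  \<open>\<langle>x \<otimes> y, x' \<otimes> y'\<rangle> = \<langle>x, x'\<rangle> \<langle>y, y'\<rangle>\<close> is definite on the algebraic tensor product, so identifying
  formal sums that have the same inner products with all others gives exactly the algebraic
  tensor product with its inner product.
\<close>

definition tensor_form :: "('a::complex_inner \<times> 'b::complex_inner) list \<Rightarrow> ('a \<times> 'b) list \<Rightarrow> complex" where
  "tensor_form us vs = (\<Sum>(x, y)\<leftarrow>us. \<Sum>(x', y')\<leftarrow>vs. cinner x x' * cinner y y')"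

lemma tensor_form_append: "tensor_form (us @ vs) ws = tensor_form us ws + tensor_form vs ws"
  by (simp add: tensor_form_def)

lemma tensor_form_Nil [simp]: "tensor_form [] ws = 0"
  by (simp add: tensor_form_def)

lemma tensor_form_Cons:
  "tensor_form ((x, y) # us) ws = (\<Sum>(x', y')\<leftarrow>ws. cinner x x' * cinner y y') + tensor_form us ws"
  by (simp add: tensor_form_def)

lemma tensor_form_commute: "tensor_form us vs = cnj (tensor_form vs us)"
proof -
  have cnj_sum_list: "cnj (sum_list zs) = (\<Sum>z\<leftarrow>zs. cnj z)" for zs
    by (induction zs) auto
  have "tensor_form us vs = (\<Sum>u\<leftarrow>us. \<Sum>v\<leftarrow>vs. cinner (fst u) (fst v) * cinner (snd u) (snd v))"
    for us vs :: "('a \<times> 'b) list"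
    by (simp add: tensor_form_def case_prod_unfold)
  moreover have "(\<Sum>u\<leftarrow>us. \<Sum>v\<leftarrow>vs. f u v) = (\<Sum>v\<leftarrow>vs. \<Sum>u\<leftarrow>us. f u v)" for f :: "_ \<Rightarrow> _ \<Rightarrow> complex"
    by (induction us) (simp_all add: sum_list_addf)
  ultimately show ?thesis
    by (simp add: cnj_sum_list o_def flip: cinner_commute)
qed

lemma tensor_form_scaleC:
  "tensor_form (map (apfst ((*\<^sub>C) c)) us) ws = c * tensor_form us ws"
  by (induction us) (auto simp: tensor_form_Cons sum_list_const_mult[symmetric] distrib_left
      case_prod_unfold mult.assoc)

lemma finite_orthonormal_expansion:
  fixes X :: "'a::complex_inner set"
  assumes "finite X"
  shows "\<exists>E. finite E \<and> (\<forall>e\<in>E. \<forall>f\<in>E. cinner e f = (if e = f then 1 else 0))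
    \<and> (\<forall>x\<in>X. x = (\<Sum>e\<in>E. cinner x e *\<^sub>C e))"
  using assms
proof (induction X)
  case empty
  then show ?case by (intro exI[of _ "{}"]) auto
next
  case (insert x X)
  then obtain E where E: "finite E" "\<And>e f. e \<in> E \<Longrightarrow> f \<in> E \<Longrightarrow> cinner e f = (if e = f then 1 else 0)"
    and X: "\<And>x. x \<in> X \<Longrightarrow> x = (\<Sum>e\<in>E. cinner x e *\<^sub>C e)" by blast
  define u where "u = x - (\<Sum>e\<in>E. cinner x e *\<^sub>C e)"
  have uE: "cinner u f = 0" if "f \<in> E" for f
  proof -
    have "(\<Sum>e\<in>E. cinner x e * cinner e f) = (\<Sum>e\<in>E. if e = f then cinner x f else 0)"
      by (intro sum.cong) (auto simp: E that)
    then show ?thesis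
      using E(1) that by (simp add: u_def cinner_diff_left cinner_sum_left)
  qed
  show ?case
  proof (cases "u = 0")
    case True
    then show ?thesis using E X by (intro exI[of _ E]) (auto simp: u_def)
  next
    case False
    define g where "g = complex_of_real (inverse (norm u)) *\<^sub>C u"
    have gE: "cinner g f = 0" "cinner f g = 0" if "f \<in> E" for f
      using uE[OF that] cinner_commute[of f u] by (auto simp: g_def)
    have gg: "cinner g g = 1"
      using False by (simp add: g_def cinner_self norm_inverse)
    have gnE: "g \<notin> E" using gE(1)[of g] gg by auto
    have xu: "x = u + (\<Sum>e\<in>E. cinner x e *\<^sub>C e)" by (simp add: u_def)
    have ug: "u = complex_of_real (norm u) *\<^sub>C g" using False by (simp add: g_def)
    have xg: "cinner x g = complex_of_real (norm u)"
    proof -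
      have "cinner x g = cinner u g + (\<Sum>e\<in>E. cinner x e * cinner e g)"
        by (subst xu) (simp add: cinner_add_left cinner_sum_left)
      also have "(\<Sum>e\<in>E. cinner x e * cinner e g) = 0" by (intro sum.neutral) (auto simp: gE)
      also have "cinner u g = complex_of_real (norm u)" by (subst ug) (simp add: gg)
      finally show ?thesis by simp
    qed
    have "\<forall>z\<in>insert x X. z = (\<Sum>e\<in>insert g E. cinner z e *\<^sub>C e)"
    proof
      fix z assume "z \<in> insert x X"
      then consider "z = x" | "z \<in> X" by blast
      then show "z = (\<Sum>e\<in>insert g E. cinner z e *\<^sub>C e)"
      proof cases
        case 1
        then show ?thesis using xu gnE E(1) by (simp add: xg flip: ug)
      next
        case 2
        have "cinner z g = cinner (\<Sum>e\<in>E. cinner z e *\<^sub>C e) g"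
          by (rule arg_cong[where f = "\<lambda>v. cinner v g", OF X[OF 2]])
        also have "\<dots> = 0"
          by (simp add: cinner_sum_left gE)
        finally show ?thesis using X[OF 2] gnE E(1) by simp
      qed
    qed
    moreover have "\<forall>e\<in>insert g E. \<forall>f\<in>insert g E. cinner e f = (if e = f then 1 else 0)"
      using gE gg gnE E by auto
    ultimately show ?thesis using E(1) by blast
  qed
qed

lemma tensor_form_self: "0 \<le> Re (tensor_form us us)" "Im (tensor_form us us) = 0"
proof -
  obtain E where E: "finite E"
    and X: "\<And>x. x \<in> fst ` set us \<Longrightarrow> x = (\<Sum>e\<in>E. cinner x e *\<^sub>C e)"
    using finite_orthonormal_expansion[of "fst ` set us"] by auto
  define w where "w e vs = (\<Sum>(x, y)\<leftarrow>vs. cinner x e *\<^sub>C y)" for e and vs :: "('a \<times> 'b) list"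
  have *: "cinner x x' * cinner y y' = (\<Sum>e\<in>E. cinner (cinner x e *\<^sub>C y) (cinner x' e *\<^sub>C y'))"
    if "x' \<in> fst ` set us" for x x' and y y' :: 'b
  proof -
    have "cinner x x' = cinner x (\<Sum>e\<in>E. cinner x' e *\<^sub>C e)"
      by (rule arg_cong[where f = "cinner x", OF X[OF that]])
    then show ?thesis by (simp add: cinner_sum_right sum_distrib_right mult.assoc mult.left_commute)
  qed
  have 1: "(\<Sum>(x', y')\<leftarrow>vs. cinner x x' * cinner y y') = (\<Sum>e\<in>E. cinner (cinner x e *\<^sub>C y) (w e vs))"
    if "set vs \<subseteq> set us" for vs x y
    using that
  proof (induction vs)
    case (Cons v vs)
    have "fst v \<in> fst ` set us" using Cons.prems by auto
    from *[OF this] show ?case using Cons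
      by (simp add: w_def case_prod_unfold cinner_add_right sum.distrib distrib_left)
  qed (simp add: w_def)
  have "tensor_form vs us = (\<Sum>e\<in>E. cinner (w e vs) (w e us))" for vs
    by (induction vs)
       (auto simp: tensor_form_Cons 1 w_def cinner_add_left sum.distrib distrib_right)
  then have "tensor_form us us = complex_of_real (\<Sum>e\<in>E. (norm (w e us))\<^sup>2)"
    by (simp add: cinner_self)
  then show "0 \<le> Re (tensor_form us us)" "Im (tensor_form us us) = 0"
    by (simp_all only: Re_complex_of_real Im_complex_of_real sum_nonneg zero_le_power2)
qed

lemma tensor_form_Cauchy_Schwarz:
  "(cmod (tensor_form us vs))\<^sup>2 \<le> Re (tensor_form us us) * Re (tensor_form vs vs)"
proof (rule semi_Cauchy_Schwarz)
  fix c
  let ?v = "map (apfst ((*\<^sub>C) c)) vs"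
  have right_append: "tensor_form ws (us @ vs) = tensor_form ws us + tensor_form ws vs"
    for ws us vs :: "('a \<times> 'b) list"
    using tensor_form_append[of us vs ws] by (metis tensor_form_commute complex_cnj_add)
  have right_scaleC: "tensor_form ws (map (apfst ((*\<^sub>C) c)) vs) = cnj c * tensor_form ws vs"
    for ws vs :: "('a \<times> 'b) list"
    using tensor_form_scaleC[of c vs ws] by (metis tensor_form_commute complex_cnj_mult)
  have "tensor_form (us @ ?v) (us @ ?v) = tensor_form us us + cnj c * tensor_form us vs
      + c * cnj (tensor_form us vs) + (c * cnj c) * tensor_form vs vs"
    using tensor_form_commute[of vs us]
    by (simp add: tensor_form_append right_append tensor_form_scaleC right_scaleC algebra_simps)
  also have "Re \<dots> = Re (tensor_form us us) + Re (cnj c * tensor_form us vs)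
      + Re (c * cnj (tensor_form us vs)) + (cmod c)\<^sup>2 * Re (tensor_form vs vs)"
    by (simp add: complex_norm_square[symmetric] flip: of_real_power)
  finally show "0 \<le> Re (tensor_form us us) + Re (cnj c * tensor_form us vs)
      + Re (c * cnj (tensor_form us vs)) + (cmod c)\<^sup>2 * Re (tensor_form vs vs)"
    using tensor_form_self(1)[of "us @ ?v"] by simp
qed (rule tensor_form_self)

quotient_type (overloaded) ('a, 'b) alg_tensor = "('a::complex_inner \<times> 'b::complex_inner) list"
  / "\<lambda>us vs. \<forall>ws. tensor_form us ws = tensor_form vs ws"
  by (auto intro!: equivpI reflpI sympI transpI)

instantiation alg_tensor :: (complex_inner, complex_inner) complex_inner
begin

lift_definition zero_alg_tensor :: "('a, 'b) alg_tensor" is "[]" .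

lift_definition plus_alg_tensor :: "('a, 'b) alg_tensor \<Rightarrow> ('a, 'b) alg_tensor \<Rightarrow> ('a, 'b) alg_tensor"
  is "(@)" by (simp add: tensor_form_append)

lift_definition scaleC_alg_tensor :: "complex \<Rightarrow> ('a, 'b) alg_tensor \<Rightarrow> ('a, 'b) alg_tensor"
  is "\<lambda>c. map (apfst ((*\<^sub>C) c))" by (simp add: tensor_form_scaleC)

definition uminus_alg_tensor :: "('a, 'b) alg_tensor \<Rightarrow> ('a, 'b) alg_tensor" where
  "uminus_alg_tensor u = (- 1) *\<^sub>C u"

definition minus_alg_tensor :: "('a, 'b) alg_tensor \<Rightarrow> ('a, 'b) alg_tensor \<Rightarrow> ('a, 'b) alg_tensor" where
  "minus_alg_tensor u v = u + (- v)"

definition scaleR_alg_tensor :: "real \<Rightarrow> ('a, 'b) alg_tensor \<Rightarrow> ('a, 'b) alg_tensor" where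
  "scaleR_alg_tensor r u = complex_of_real r *\<^sub>C u"

lift_definition cinner_alg_tensor :: "('a, 'b) alg_tensor \<Rightarrow> ('a, 'b) alg_tensor \<Rightarrow> complex"
  is tensor_form
  by (metis tensor_form_commute)

definition norm_alg_tensor :: "('a, 'b) alg_tensor \<Rightarrow> real" where
  "norm_alg_tensor u = sqrt (Re (cinner u u))"

definition dist_alg_tensor :: "('a, 'b) alg_tensor \<Rightarrow> ('a, 'b) alg_tensor \<Rightarrow> real" where
  "dist_alg_tensor u v = norm (u - v)"

definition sgn_alg_tensor :: "('a, 'b) alg_tensor \<Rightarrow> ('a, 'b) alg_tensor" where
  "sgn_alg_tensor u = scaleR (inverse (norm u)) u"

definition [code del]:
  "(uniformity :: (('a, 'b) alg_tensor \<times> ('a, 'b) alg_tensor) filter)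
    = (INF e\<in>{0 <..}. principal {(u, v). dist u v < e})"

definition open_alg_tensor :: "('a, 'b) alg_tensor set \<Rightarrow> bool" where
  "open_alg_tensor U \<longleftrightarrow> (\<forall>u\<in>U. eventually (\<lambda>(u', v). u' = u \<longrightarrow> v \<in> U) uniformity)"

instance
proof
  fix x y z :: "('a, 'b) alg_tensor" and c d :: complex and a b r :: real
  have add_right: "c *\<^sub>C (x + y) = c *\<^sub>C x + c *\<^sub>C y" for c and x y :: "('a, 'b) alg_tensor"
    by transfer simp
  have add_left: "(c + d) *\<^sub>C x = c *\<^sub>C x + d *\<^sub>C x" for c d and x :: "('a, 'b) alg_tensor"
    by transfer (simp add: tensor_form_append tensor_form_scaleC distrib_right)
  have assoc: "c *\<^sub>C d *\<^sub>C x = (c * d) *\<^sub>C x" for c d and x :: "('a, 'b) alg_tensor"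
    by transfer (simp only: tensor_form_scaleC mult.assoc simp_thms)
  have one: "1 *\<^sub>C x = x" for x :: "('a, 'b) alg_tensor"
    by transfer (simp add: tensor_form_scaleC)
  have zero: "0 *\<^sub>C x = 0" for x :: "('a, 'b) alg_tensor"
    by transfer (simp add: tensor_form_scaleC)
  show "x + y + z = x + (y + z)"
    by transfer simp
  show "x + y = y + x"
    by transfer (simp add: tensor_form_append)
  show "0 + x = x"
    by transfer simp
  show "- x + x = 0"
    using add_left[of "-1" 1 x] by (simp add: uminus_alg_tensor_def one zero)
  show "x - y = x + - y"
    by (rule minus_alg_tensor_def)
  show "a *\<^sub>R (x + y) = a *\<^sub>R x + a *\<^sub>R y" "(a + b) *\<^sub>R x = a *\<^sub>R x + b *\<^sub>R x"
    "a *\<^sub>R b *\<^sub>R x = (a * b) *\<^sub>R x" "1 *\<^sub>R x = x" "r *\<^sub>R x = complex_of_real r *\<^sub>C x"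
    by (simp_all add: scaleR_alg_tensor_def add_right add_left assoc one)
  show "c *\<^sub>C (x + y) = c *\<^sub>C x + c *\<^sub>C y" "(c + d) *\<^sub>C x = c *\<^sub>C x + d *\<^sub>C x"
    "c *\<^sub>C d *\<^sub>C x = (c * d) *\<^sub>C x" "1 *\<^sub>C x = x"
    by (fact add_right add_left assoc one)+
  show "dist x y = norm (x - y)" by (rule dist_alg_tensor_def)
  show "sgn x = scaleR (inverse (norm x)) x" by (rule sgn_alg_tensor_def)
  show "(uniformity :: (('a, 'b) alg_tensor \<times> ('a, 'b) alg_tensor) filter)
    = (INF e\<in>{0 <..}. principal {(x, y). dist x y < e})"
    by (rule uniformity_alg_tensor_def)
  show "open U \<longleftrightarrow> (\<forall>x\<in>U. \<forall>\<^sub>F (x', y) in uniformity. x' = x \<longrightarrow> y \<in> U)"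
    for U :: "('a, 'b) alg_tensor set"
    by (rule open_alg_tensor_def)
  show "norm x = sqrt (Re (cinner x x))" by (rule norm_alg_tensor_def)
  show commute: "cinner x y = cnj (cinner y x)" for x y :: "('a, 'b) alg_tensor"
    by transfer (rule tensor_form_commute)
  show inner_add: "cinner (x + y) z = cinner x z + cinner y z" for x y z :: "('a, 'b) alg_tensor"
    by transfer (rule tensor_form_append)
  show inner_scaleC: "cinner (c *\<^sub>C x) y = c * cinner x y" for c and x y :: "('a, 'b) alg_tensor"
    by transfer (rule tensor_form_scaleC)
  show ge: "0 \<le> Re (cinner x x)" for x :: "('a, 'b) alg_tensor"
    by transfer (rule tensor_form_self)
  have inner_Im: "Im (cinner x x) = 0" for x :: "('a, 'b) alg_tensor"
    by transfer (rule tensor_form_self)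
  have CS: "(cmod (cinner x y))\<^sup>2 \<le> Re (cinner x x) * Re (cinner y y)" for x y :: "('a, 'b) alg_tensor"
    by transfer (rule tensor_form_Cauchy_Schwarz)
  have ext: "x = 0" if "\<And>y. cinner x y = 0" for x :: "('a, 'b) alg_tensor"
    using that by transfer simp
  show eq_0: "cinner x x = 0 \<longleftrightarrow> x = 0" for x :: "('a, 'b) alg_tensor"
  proof
    show "x = 0" if "cinner x x = 0"
    proof (rule ext)
      show "cinner x y = 0" for y using CS[of x y] that by simp
    qed
    show "cinner x x = 0" if "x = 0"
      using inner_scaleC[of 0 x x] by (simp add: that zero)
  qed
  show "norm x = 0 \<longleftrightarrow> x = 0"
    using eq_0[of x] inner_Im[of x] by (simp add: norm_alg_tensor_def complex_eq_iff)
  show "norm (a *\<^sub>R x) = \<bar>a\<bar> * norm x"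
  proof -
    have "cinner (a *\<^sub>R x) (a *\<^sub>R x) = complex_of_real a * complex_of_real a * cinner x x"
      unfolding scaleR_alg_tensor_def inner_scaleC
      using commute[of x "complex_of_real a *\<^sub>C x"] commute[of x x] by (simp add: inner_scaleC)
    then show ?thesis
      by (simp add: norm_alg_tensor_def real_sqrt_mult flip: of_real_mult)
  qed
  show "norm (x + y) \<le> norm x + norm y"
  proof (rule power2_le_imp_le)
    have n: "(norm x)\<^sup>2 = Re (cinner x x)" for x :: "('a, 'b) alg_tensor"
      by (simp add: norm_alg_tensor_def ge)
    have "(cmod (cinner x y))\<^sup>2 \<le> (norm x * norm y)\<^sup>2"
      using CS[of x y] by (simp add: power_mult_distrib n)
    moreover have "0 \<le> norm x * norm y"
      by (simp add: norm_alg_tensor_def ge)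
    ultimately have "Re (cinner x y) \<le> norm x * norm y"
      by (meson complex_Re_le_cmod order_trans power2_le_imp_le)
    moreover have "cinner (x + y) (x + y) = cinner x x + cinner x y + cnj (cinner x y) + cinner y y"
      using commute[of x "x + y"] commute[of y "x + y"] commute[of y x] commute[of x x] commute[of y y]
      by (simp add: inner_add)
    ultimately show "(norm (x + y))\<^sup>2 \<le> (norm x + norm y)\<^sup>2"
      by (simp add: n power2_sum)
  qed (simp add: norm_alg_tensor_def ge)
qed

end

type_synonym ('a, 'b) htensor = "('a, 'b) alg_tensor completion"

lift_definition pure_alg_tensor :: "'a::complex_inner \<Rightarrow> 'b::complex_inner \<Rightarrow> ('a, 'b) alg_tensor"
  is "\<lambda>x y. [(x, y)]" .

definition htensor :: "'a::complex_inner \<Rightarrow> 'b::complex_inner \<Rightarrow> ('a, 'b) htensor" (infixr "\<otimes>\<^sub>H" 70)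
  where "x \<otimes>\<^sub>H y = to_completion (pure_alg_tensor x y)"

lemma cinner_htensor [simp]: "cinner (x \<otimes>\<^sub>H y) (x' \<otimes>\<^sub>H y') = cinner x x' * cinner y y'"
  unfolding htensor_def cinner_to_completion by transfer (simp add: tensor_form_def)

lemma htensor_add_left: "(x + x') \<otimes>\<^sub>H y = x \<otimes>\<^sub>H y + x' \<otimes>\<^sub>H y"
  unfolding htensor_def to_completion_add[symmetric]
  by (rule arg_cong[where f = to_completion], transfer)
     (auto simp: tensor_form_Cons cinner_add_left distrib_right case_prod_unfold sum_list_addf)

lemma htensor_add_right: "x \<otimes>\<^sub>H (y + y') = x \<otimes>\<^sub>H y + x \<otimes>\<^sub>H y'"
  unfolding htensor_def to_completion_add[symmetric]
  by (rule arg_cong[where f = to_completion], transfer)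
     (auto simp: tensor_form_Cons cinner_add_left distrib_left case_prod_unfold sum_list_addf)

lemma htensor_scaleC_left: "(c *\<^sub>C x) \<otimes>\<^sub>H y = c *\<^sub>C (x \<otimes>\<^sub>H y)"
  unfolding htensor_def to_completion_scaleC[symmetric]
  by (rule arg_cong[where f = to_completion], transfer) simp

lemma htensor_scaleC_right: "x \<otimes>\<^sub>H (c *\<^sub>C y) = c *\<^sub>C (x \<otimes>\<^sub>H y)"
  unfolding htensor_def to_completion_scaleC[symmetric]
  by (rule arg_cong[where f = to_completion], transfer)
     (simp add: tensor_form_Cons mult.left_commute mult.assoc)

lemma htensor_total:
  "closure {\<Sum>(x, y)\<leftarrow>us. x \<otimes>\<^sub>H y |us. True} = (UNIV :: ('a::complex_inner, 'b::complex_inner) htensor set)"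
proof -
  have Nil: "to_completion (abs_alg_tensor []) = (0 :: ('a, 'b) htensor)"
    using to_completion_scaleC[of 0 "0::('a, 'b) alg_tensor"] by (simp add: zero_alg_tensor_def)
  have *: "to_completion (abs_alg_tensor us) = (\<Sum>(x, y)\<leftarrow>us. x \<otimes>\<^sub>H y)" for us :: "('a \<times> 'b) list"
  proof (induction us)
    case (Cons u us)
    have "abs_alg_tensor (u # us) = pure_alg_tensor (fst u) (snd u) + abs_alg_tensor us"
      by (simp add: pure_alg_tensor.abs_eq plus_alg_tensor.abs_eq)
    then show ?case using Cons
      by (simp add: to_completion_add htensor_def case_prod_unfold)
  qed (simp add: Nil)
  have "to_completion v \<in> {\<Sum>(x, y)\<leftarrow>us. x \<otimes>\<^sub>H y |us. True}" for v :: "('a, 'b) alg_tensor"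
  proof -
    have "v = abs_alg_tensor (rep_alg_tensor v)"
      by (rule Quotient_abs_rep[OF Quotient_alg_tensor, symmetric])
    then show ?thesis using *[of "rep_alg_tensor v"] by auto
  qed
  then have "range to_completion \<subseteq> {\<Sum>(x, y)\<leftarrow>us. (x::'a) \<otimes>\<^sub>H (y::'b) |us. True}" by blast
  then show ?thesis using closure_mono to_completion_dense by (metis top.extremum_uniqueI)
qed

section \<open>Bounded operators\<close>

definition bounded_clinear :: "('a::complex_inner \<Rightarrow> 'b::complex_inner) \<Rightarrow> bool" where
  "bounded_clinear T \<longleftrightarrow> bounded_linear T \<and> (\<forall>c x. T (c *\<^sub>C x) = c *\<^sub>C T x)"

definition cadjoint :: "('a::complex_hilbert_space \<Rightarrow> 'b::complex_hilbert_space) \<Rightarrow> 'b \<Rightarrow> 'a" where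
  "cadjoint T = (THE S. bounded_clinear S \<and> (\<forall>x y. cinner (T x) y = cinner x (S y)))"

definition invertible_op :: "('a::complex_hilbert_space \<Rightarrow> 'a) \<Rightarrow> bool" where
  "invertible_op T \<longleftrightarrow> bounded_clinear T \<and> bij T \<and> bounded_clinear (inv T)"

definition isometry_op :: "('a::complex_hilbert_space \<Rightarrow> 'b::complex_hilbert_space) \<Rightarrow> bool" where
  "isometry_op V \<longleftrightarrow> bounded_clinear V \<and> (\<forall>x. norm (V x) = norm x)"

definition tensor_op :: "('a::complex_hilbert_space \<Rightarrow> 'c::complex_hilbert_space) \<Rightarrow>
    ('b::complex_hilbert_space \<Rightarrow> 'd::complex_hilbert_space) \<Rightarrow> ('a, 'b) htensor \<Rightarrow> ('c, 'd) htensor"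
  (infixr "\<otimes>\<^sub>o" 70)
  where "A \<otimes>\<^sub>o B = (THE W. bounded_clinear W \<and> (\<forall>x y. W (x \<otimes>\<^sub>H y) = A x \<otimes>\<^sub>H B y))"

definition quantum_annulus_unitary :: "real \<Rightarrow> ('h::complex_hilbert_space \<Rightarrow> 'h) \<Rightarrow> bool" where
  "quantum_annulus_unitary r J \<longleftrightarrow> invertible_op J \<and>
    (\<forall>x. (r\<^sup>2 + 1 / r\<^sup>2) *\<^sub>R x - (cadjoint J \<circ> J) x - inv (cadjoint J \<circ> J) x = 0)"

end

theory Submission
  imports Defs
begin

text \<open>
  Write \<open>T = J\<^sup>*J\<close>, \<open>K = J\<^sup>-\<^sup>*\<close>, \<open>q = r\<^sup>2 + r\<^sup>-\<^sup>2\<close> and \<open>V = A \<otimes> J + B \<otimes> K\<close>. Since \<open>J\<^sup>*K = K\<^sup>*J = I\<close> and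
  \<open>K\<^sup>*K = T\<^sup>-\<^sup>1\<close>, expanding the product gives
  \<open>V\<^sup>*V = A\<^sup>*A \<otimes> T + (A\<^sup>*B + B\<^sup>*A) \<otimes> I + B\<^sup>*B \<otimes> T\<^sup>-\<^sup>1\<close>.

  If \<open>A\<^sup>*A = B\<^sup>*B\<close>, the outer terms combine to \<open>A\<^sup>*A \<otimes> (T + T\<^sup>-\<^sup>1) = q A\<^sup>*A \<otimes> I\<close>, and the second operator
  equation says precisely that \<open>V\<^sup>*V = I\<close>.

  Conversely, \<open>T + T\<^sup>-\<^sup>1 = q\<close> means \<open>(T - r\<^sup>2) (T - r\<^sup>-\<^sup>2) = 0\<close>, and because both \<open>J\<close> and \<open>J\<^sup>-\<^sup>1\<close> have norm
  \<open>r > 1\<close>, neither factor vanishes: both \<open>r\<^sup>2\<close> and \<open>r\<^sup>-\<^sup>2\<close> are eigenvalues of \<open>T\<close>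
  (\<open>quantum_annulus_eigenvector\<close>). Evaluating \<open>\<parallel>V (x \<otimes> h)\<parallel> = \<parallel>x \<otimes> h\<parallel>\<close> at a unit eigenvector \<open>h\<close> of each kind
  yields \<open>\<lambda> \<parallel>A x\<parallel>\<^sup>2 + 2 Re \<langle>A x, B x\<rangle> + \<lambda>\<^sup>-\<^sup>1 \<parallel>B x\<parallel>\<^sup>2 = \<parallel>x\<parallel>\<^sup>2\<close> for \<open>\<lambda> = r\<^sup>2\<close> and for \<open>\<lambda> = r\<^sup>-\<^sup>2\<close>. The
  difference of the two identities is \<open>\<parallel>A x\<parallel> = \<parallel>B x\<parallel>\<close>, and either of them then becomes the quadratic form of
  the second operator equation; a complex operator is determined by its quadratic form
  (\<open>clinear_eq_0_if_form_eq_0\<close>).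

  Adjoints and tensor products of operators are given by definite descriptions, so each needs an
  existence proof before it can be computed with: \<open>cadjoint\<close> rests on the Riesz representation of
  functionals, and \<open>tensor_op\<close> on a norm bound for finite sums of pure tensors, followed by
  extension to the completion. All computations with \<open>V\<close> then take place on pure tensors, whose
  finite sums are dense (\<open>isometry_opI_pure\<close>).
\<close>

section \<open>Bounded complex-linear maps\<close>

lemma bounded_clinear_simps:
  assumes "bounded_clinear T"
  shows "bounded_linear T" "T (x + y) = T x + T y" "T (x - y) = T x - T y"
    "T (c *\<^sub>C x) = c *\<^sub>C T x" "T 0 = 0" "T (t *\<^sub>R x) = t *\<^sub>R T x"
  using assms
  by (auto simp: bounded_clinear_def linear_simps bounded_linear.linear linear_0)

lemma bounded_clinearI:
  fixes T :: "'a::complex_inner \<Rightarrow> 'b::complex_inner"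
  assumes "\<And>x y. T (x + y) = T x + T y" "\<And>c x. T (c *\<^sub>C x) = c *\<^sub>C T x"
    and "\<And>x. norm (T x) \<le> K * norm x"
  shows "bounded_clinear T"
  unfolding bounded_clinear_def
  using assms by (auto simp: scaleR_scaleC mult.commute intro!: bounded_linear_intro[where K = K])

lemma bounded_clinear_add:
  assumes "bounded_clinear S" "bounded_clinear T"
  shows "bounded_clinear (\<lambda>x. S x + T x)"
  using assms by (auto simp: bounded_clinear_def bounded_linear_add scaleC_add_right)

lemma scaleC_diff_right: "c *\<^sub>C (x - y) = c *\<^sub>C x - c *\<^sub>C (y::'a::complex_inner)"
  by (rule linear_diff[OF bounded_linear.linear[OF bounded_linear_scaleC]])

lemma cinner_scaleR_right [simp]: "cinner x (t *\<^sub>R y) = of_real t * cinner x (y::'a::complex_inner)"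
  by (simp add: scaleR_scaleC)

lemma cinner_ext:
  assumes "\<And>x. cinner x y = cinner x (z::'a::complex_inner)"
  shows "y = z"
  using assms[of "y - z"] cinner_diff_right[of "y - z" y z] by simp

lemma norm_add_square:
  "(norm (x + y))\<^sup>2 = (norm x)\<^sup>2 + 2 * Re (cinner x y) + (norm (y::'a::complex_inner))\<^sup>2"
proof -
  have "complex_of_real ((norm (x + y))\<^sup>2) = cinner x x + cinner x y + cnj (cinner x y) + cinner y y"
    using cinner_commute[of y x] by (simp only: cinner_self[symmetric] cinner_add_left cinner_add_right) simp
  then have "Re (complex_of_real ((norm (x + y))\<^sup>2)) = Re (cinner x x + cinner x y + cnj (cinner x y) + cinner y y)"
    by simp
  then show ?thesis by (simp add: cinner_self flip: of_real_power)
qed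

text \<open>
  Over the complex numbers the quadratic form determines the operator: the two mixed terms of the
  form at \<open>x + y\<close> and at \<open>x + \<i> y\<close> cannot both cancel unless each of them vanishes.
\<close>

lemma clinear_eq_0_if_form_eq_0:
  fixes S :: "'a::complex_inner \<Rightarrow> 'a"
  assumes add: "\<And>x y. S (x + y) = S x + S y" and scale: "\<And>c x. S (c *\<^sub>C x) = c *\<^sub>C S x"
    and form: "\<And>x. cinner (S x) x = 0"
  shows "S x = 0"
proof -
  have mixed: "cnj c * cinner (S x) y + c * cinner (S y) x = 0" for c x y
    using form[of "x + c *\<^sub>C y"] form[of x] form[of y]
    by (simp add: add scale cinner_add_left cinner_add_right algebra_simps)
  have "cinner (S x) y = 0" for y
    using mixed[of 1 x y] mixed[of \<i> x y] by (simp add: add_eq_0_iff)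
  from this[of "S x"] show ?thesis by simp
qed


section \<open>Riesz representation and adjoints\<close>

text \<open>
  The representing vector is the minimiser of \<open>\<phi> x = \<parallel>x\<parallel>\<^sup>2 - 2 Re (f x)\<close>. The parallelogram law makes
  \<open>\<phi>\<close> uniformly convex, so every minimising sequence is Cauchy; the first-order condition at the
  limit is the claimed identity for real parts, and its instance at \<open>\<i> x\<close> gives the imaginary parts.
\<close>

lemma riesz_representation:
  fixes f :: "'a::complex_hilbert_space \<Rightarrow> complex"
  assumes f: "bounded_linear f" and scale: "\<And>c x. f (c *\<^sub>C x) = c * f x"
  shows "\<exists>v. \<forall>x. f x = cinner x v"
proof -
  interpret f: bounded_linear f by (rule f)
  define \<phi> where "\<phi> x = (norm x)\<^sup>2 - 2 * Re (f x)" for x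
  obtain K where K: "\<And>x. norm (f x) \<le> norm x * K" using f.bounded by blast
  have "- K\<^sup>2 \<le> \<phi> x" for x
  proof -
    have "Re (f x) \<le> norm x * K" using K[of x] complex_Re_le_cmod[of "f x"] by linarith
    moreover have "0 \<le> (norm x - K)\<^sup>2" by simp
    ultimately show ?thesis by (simp add: \<phi>_def power2_diff)
  qed
  then have bdd: "bdd_below (range \<phi>)" by (intro bdd_belowI[of _ "- K\<^sup>2"]) auto
  define m where "m = Inf (range \<phi>)"
  have m: "m \<le> \<phi> x" for x unfolding m_def by (rule cInf_lower[OF _ bdd]) simp
  have "\<exists>x. \<phi> x < m + inverse (real (Suc n))" for n
    using cInf_lessD[of "range \<phi>" "m + inverse (real (Suc n))"] by (auto simp: m_def)
  then obtain X where X: "\<And>n. \<phi> (X n) < m + inverse (real (Suc n))" by metis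
  have convex: "(norm (x - y))\<^sup>2 \<le> 2 * (\<phi> x - m) + 2 * (\<phi> y - m)" for x y
  proof -
    have "(norm (x + y))\<^sup>2 + (norm (x - y))\<^sup>2 = 2 * (norm x)\<^sup>2 + 2 * (norm y)\<^sup>2"
      using norm_add_square[of x y] norm_add_square[of x "- y"] by simp
    moreover have "4 * \<phi> ((1/2) *\<^sub>R u) = (norm u)\<^sup>2 - 4 * Re (f u)" for u
      by (simp add: \<phi>_def f.scaleR power_divide)
    from this[of "x + y"] have "4 * \<phi> ((1/2) *\<^sub>R (x + y)) = (norm (x + y))\<^sup>2 - 4 * (Re (f x) + Re (f y))"
      by (simp only: f.add plus_complex.sel)
    ultimately show ?thesis using m[of "(1/2) *\<^sub>R (x + y)"] by (simp add: \<phi>_def)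
  qed
  have "Cauchy X"
  proof (rule CauchyI)
    fix e :: real assume e: "0 < e"
    then obtain N where N: "inverse (real (Suc N)) < e\<^sup>2 / 4"
      using reals_Archimedean[of "e\<^sup>2 / 4"] by auto
    have "norm (X i - X j) < e" if "i \<ge> N" "j \<ge> N" for i j
    proof (rule power2_less_imp_less)
      have close: "\<phi> (X k) - m < e\<^sup>2 / 4" if "k \<ge> N" for k
      proof -
        have "inverse (real (Suc k)) \<le> inverse (real (Suc N))"
          using that by (intro le_imp_inverse_le) auto
        with X[of k] N show ?thesis by argo
      qed
      show "(norm (X i - X j))\<^sup>2 < e\<^sup>2"
        using convex[of "X i" "X j"] close[OF that(1)] close[OF that(2)] by argo
    qed (use e in simp)
    then show "\<exists>N. \<forall>i\<ge>N. \<forall>j\<ge>N. norm (X i - X j) < e" by blast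
  qed
  then obtain v where v: "X \<longlonglongrightarrow> v" using Cauchy_convergent convergent_def by blast
  have "(\<lambda>n. \<phi> (X n)) \<longlonglongrightarrow> \<phi> v"
    unfolding \<phi>_def by (intro tendsto_intros v f.tendsto)
  moreover have "(\<lambda>n. m + inverse (real (Suc n))) \<longlonglongrightarrow> m"
    using tendsto_add[OF tendsto_const LIMSEQ_inverse_real_of_nat, of m] by simp
  ultimately have "\<phi> v \<le> m"
    by (rule LIMSEQ_le) (use X less_imp_le in blast)
  then have min: "\<phi> v \<le> \<phi> x" for x using m[of x] by linarith
  have Re: "Re (f u) = Re (cinner u v)" for u
  proof -
    define s where "s = Re (cinner v u) - Re (f u)"
    have *: "0 \<le> 2 * t * s + t\<^sup>2 * (norm u)\<^sup>2" for t
      using min[of "v + t *\<^sub>R u"]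
      by (simp add: \<phi>_def norm_add_square f.add f.scaleR s_def power_mult_distrib algebra_simps)
    \<comment> \<open>The step \<open>t = - s / (1 + \<parallel>u\<parallel>\<^sup>2)\<close> would decrease \<open>\<phi>\<close> if \<open>s\<close> were nonzero.\<close>
    define d where "d = 1 + (norm u)\<^sup>2"
    have d: "d > 0" "(norm u)\<^sup>2 = d - 1" by (auto simp: d_def add_pos_nonneg)
    have "2 * (- s / d) * s + (- s / d)\<^sup>2 * (d - 1) = - (s\<^sup>2 * (d + 1) / d\<^sup>2)"
      using d(1) by (simp add: field_simps power2_eq_square)
    then have "s\<^sup>2 * (d + 1) / d\<^sup>2 \<le> 0"
      using *[of "- s / d"] d(2) by simp
    then have "s = 0"
      using d by (simp add: divide_le_0_iff mult_le_0_iff)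
    then show ?thesis using cinner_commute[of u v] by (simp add: s_def)
  qed
  have "f x = cinner x v" for x
    using Re[of x] Re[of "\<i> *\<^sub>C x"] by (intro complex_eqI) (simp_all add: scale)
  then show ?thesis by blast
qed

lemma bounded_linear_cinner_left: "bounded_linear (\<lambda>x. cinner x (y::'a::complex_inner))"
  by (rule bounded_linear_intro[where K = "norm y"])
     (auto simp: cinner_add_left scaleR_conv_of_real Cauchy_Schwarz_cinner)

lemma cadjoint:
  fixes T :: "'a::complex_hilbert_space \<Rightarrow> 'b::complex_hilbert_space"
  assumes T: "bounded_clinear T"
  shows bounded_clinear_cadjoint: "bounded_clinear (cadjoint T)"
    and cinner_cadjoint_right: "cinner x (cadjoint T y) = cinner (T x) y"
proof -
  have bl: "bounded_linear T" by (rule bounded_clinear_simps[OF T])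
  have "\<exists>v. \<forall>x. cinner (T x) y = cinner x v" for y
    by (rule riesz_representation)
       (simp_all add: bounded_clinear_simps[OF T] bounded_linear_compose[OF bounded_linear_cinner_left bl])
  then obtain S where S: "\<And>x y. cinner (T x) y = cinner x (S y)" by metis
  have "bounded_clinear S"
  proof (rule bounded_clinearI[where K = "onorm T"])
    fix y
    have "cmod (cinner (S y) (S y)) = cmod (cinner (T (S y)) y)" by (simp add: S)
    then have "(norm (S y))\<^sup>2 = cmod (cinner (T (S y)) y)"
      by (simp only: cinner_self norm_of_real abs_power2)
    also have "\<dots> \<le> norm (T (S y)) * norm y" by (rule Cauchy_Schwarz_cinner)
    also have "\<dots> \<le> onorm T * norm (S y) * norm y"
      by (intro mult_right_mono onorm[OF bl]) simp
    finally have "norm (S y) * norm (S y) \<le> (onorm T * norm y) * norm (S y)"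
      by (simp add: power2_eq_square mult_ac)
    then show "norm (S y) \<le> onorm T * norm y"
      using onorm_pos_le[OF bl] by (cases "S y = 0") auto
  qed (rule cinner_ext; simp add: cinner_add_right flip: S)+
  have "cadjoint T = S"
    unfolding cadjoint_def
  proof (rule the_equality)
    show "bounded_clinear S \<and> (\<forall>x y. cinner (T x) y = cinner x (S y))"
      using S \<open>bounded_clinear S\<close> by blast
    show "S' = S" if "bounded_clinear S' \<and> (\<forall>x y. cinner (T x) y = cinner x (S' y))" for S'
      by (rule ext, rule cinner_ext) (metis S that)
  qed
  then show "bounded_clinear (cadjoint T)" "cinner x (cadjoint T y) = cinner (T x) y"
    by (simp_all add: S \<open>bounded_clinear S\<close>)
qed

lemma cinner_cadjoint_left:
  "bounded_clinear T \<Longrightarrow> cinner (cadjoint T y) x = cinner y (T x)"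
  by (metis cinner_cadjoint_right cinner_commute)


section \<open>Tensor products of bounded operators\<close>

text \<open>
  Working with the graph rather than with a function on a dense subspace makes well-definedness a
  consequence of the norm bound: the closure of \<open>\<Gamma>\<close> contains \<open>(0, w)\<close> only for \<open>w = 0\<close>, so it is again
  a graph. Its domain is everything because the second components inherit the Cauchy property from
  the first ones.
\<close>

lemma dense_graph_extension:
  fixes \<Gamma> :: "('a::complex_inner \<times> 'b::complex_hilbert_space) set"
  assumes add: "\<And>p q. p \<in> \<Gamma> \<Longrightarrow> q \<in> \<Gamma> \<Longrightarrow> (fst p + fst q, snd p + snd q) \<in> \<Gamma>"
    and scale: "\<And>p c. p \<in> \<Gamma> \<Longrightarrow> (c *\<^sub>C fst p, c *\<^sub>C snd p) \<in> \<Gamma>"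
    and bound: "\<And>p. p \<in> \<Gamma> \<Longrightarrow> norm (snd p) \<le> K * norm (fst p)"
    and dense: "closure (fst ` \<Gamma>) = UNIV"
  shows "\<exists>W. bounded_clinear W \<and> (\<forall>p\<in>\<Gamma>. W (fst p) = snd p)"
proof -
  define L where "L z w \<longleftrightarrow>
    (\<exists>s. (\<forall>n. s n \<in> \<Gamma>) \<and> (\<lambda>n. fst (s n)) \<longlonglongrightarrow> z \<and> (\<lambda>n. snd (s n)) \<longlonglongrightarrow> w)" for z w
  have diff: "(fst p - fst q, snd p - snd q) \<in> \<Gamma>" if "p \<in> \<Gamma>" "q \<in> \<Gamma>" for p q
    using add[OF that(1) scale[OF that(2), of "-1"]] by (simp add: scaleC_minus_one)
  have L_bound: "norm w \<le> K * norm z" if "L z w" for z w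
  proof -
    obtain s where s: "\<And>n. s n \<in> \<Gamma>" "(\<lambda>n. fst (s n)) \<longlonglongrightarrow> z" "(\<lambda>n. snd (s n)) \<longlonglongrightarrow> w"
      using \<open>L z w\<close> unfolding L_def by metis
    show ?thesis
      by (rule LIMSEQ_le[OF tendsto_norm[OF s(3)] tendsto_mult_left[OF tendsto_norm[OF s(2)]]])
         (use bound s(1) in blast)
  qed
  have L_add: "L (z + z') (w + w')" if "L z w" "L z' w'" for z z' w w'
  proof -
    obtain s t where "\<And>n. s n \<in> \<Gamma>" "(\<lambda>n. fst (s n)) \<longlonglongrightarrow> z" "(\<lambda>n. snd (s n)) \<longlonglongrightarrow> w"
      "\<And>n. t n \<in> \<Gamma>" "(\<lambda>n. fst (t n)) \<longlonglongrightarrow> z'" "(\<lambda>n. snd (t n)) \<longlonglongrightarrow> w'"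
      using \<open>L z w\<close> \<open>L z' w'\<close> unfolding L_def by metis
    then show ?thesis unfolding L_def
      by (intro exI[of _ "\<lambda>n. (fst (s n) + fst (t n), snd (s n) + snd (t n))"])
         (simp add: add tendsto_add)
  qed
  have L_scale: "L (c *\<^sub>C z) (c *\<^sub>C w)" if "L z w" for c z w
  proof -
    obtain s where "\<And>n. s n \<in> \<Gamma>" "(\<lambda>n. fst (s n)) \<longlonglongrightarrow> z" "(\<lambda>n. snd (s n)) \<longlonglongrightarrow> w"
      using \<open>L z w\<close> unfolding L_def by metis
    then show ?thesis unfolding L_def
      by (intro exI[of _ "\<lambda>n. (c *\<^sub>C fst (s n), c *\<^sub>C snd (s n))"])
         (simp add: scale bounded_linear.tendsto[OF bounded_linear_scaleC])
  qed
  have L_unique: "w = w'" if "L z w" "L z w'" for z w w'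
    using L_bound[OF L_add[OF that(1) L_scale[OF that(2), of "-1"]]]
    by (simp add: scaleC_minus_one)
  have "\<exists>w. L z w" for z
  proof -
    obtain t where t: "\<And>n. t n \<in> fst ` \<Gamma>" "t \<longlonglongrightarrow> z"
      using dense closure_sequential[of z "fst ` \<Gamma>"] by auto
    then have "\<forall>n. \<exists>p. p \<in> \<Gamma> \<and> fst p = t n" by (metis image_iff)
    then obtain s where s: "\<And>n. s n \<in> \<Gamma>" "\<And>n. fst (s n) = t n" by metis
    have "Cauchy (\<lambda>n. snd (s n))"
    proof (rule CauchyI)
      fix e :: real assume e: "0 < e"
      obtain N where N: "\<And>m n. m \<ge> N \<Longrightarrow> n \<ge> N \<Longrightarrow> norm (t m - t n) < e / (\<bar>K\<bar> + 1)"
        using CauchyD[OF LIMSEQ_imp_Cauchy[OF t(2)], of "e / (\<bar>K\<bar> + 1)"] e by auto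
      have "norm (snd (s m) - snd (s n)) < e" if "m \<ge> N" "n \<ge> N" for m n
      proof -
        have "norm (snd (s m) - snd (s n)) \<le> K * norm (t m - t n)"
          using bound[OF diff[OF s(1)[of m] s(1)[of n]]] by (simp add: s(2))
        also have "\<dots> \<le> (\<bar>K\<bar> + 1) * norm (t m - t n)" by (intro mult_right_mono) auto
        also have "\<dots> < e" using N[OF that] by (simp add: field_simps)
        finally show ?thesis .
      qed
      then show "\<exists>N. \<forall>m\<ge>N. \<forall>n\<ge>N. norm (snd (s m) - snd (s n)) < e" by blast
    qed
    then obtain w where "(\<lambda>n. snd (s n)) \<longlonglongrightarrow> w" using Cauchy_convergent convergent_def by blast
    moreover have "(\<lambda>n. fst (s n)) \<longlonglongrightarrow> z" using t(2) by (simp add: s(2))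
    ultimately show ?thesis using s(1) unfolding L_def by blast
  qed
  then obtain W where W: "\<And>z. L z (W z)" by metis
  have "bounded_clinear W"
    by (rule bounded_clinearI[where K = K]) (blast intro: L_unique L_add L_scale L_bound W)+
  moreover have "W (fst p) = snd p" if "p \<in> \<Gamma>" for p
  proof -
    have "L (fst p) (snd p)" unfolding L_def using that by (intro exI[of _ "\<lambda>_. p"]) simp
    then show ?thesis by (rule L_unique[OF W])
  qed
  ultimately show ?thesis by blast
qed

definition tensor_sum :: "('a::complex_inner \<times> 'b::complex_inner) list \<Rightarrow> ('a, 'b) htensor" where
  "tensor_sum us = (\<Sum>(x, y)\<leftarrow>us. x \<otimes>\<^sub>H y)"

lemma tensor_sum_simps [simp]:
  "tensor_sum [] = 0" "tensor_sum ((x, y) # us) = x \<otimes>\<^sub>H y + tensor_sum us"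
  "tensor_sum (us @ vs) = tensor_sum us + tensor_sum vs"
  by (simp_all add: tensor_sum_def)

lemma closure_range_tensor_sum: "closure (range tensor_sum) = UNIV"
proof -
  have "range tensor_sum = {\<Sum>(x, y)\<leftarrow>us. (x::'a) \<otimes>\<^sub>H (y::'b) |us. True}"
    by (auto simp: tensor_sum_def)
  then show ?thesis using htensor_total by metis
qed

lemma scaleC_tensor_sum: "c *\<^sub>C tensor_sum us = tensor_sum (map (apfst ((*\<^sub>C) c)) us)"
proof (induction us)
  case Nil
  show ?case using scaleC_diff_right[of c 0 "0::('a,'b) htensor"] by simp
qed (auto simp: scaleC_add_right htensor_scaleC_left)

lemma bounded_clinear_tensor_sum:
  assumes "bounded_clinear W"
  shows "W (tensor_sum us) = (\<Sum>(x, y)\<leftarrow>us. W (x \<otimes>\<^sub>H y))"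
  by (induction us) (auto simp: bounded_clinear_simps[OF assms])

lemma htensor_zero: "0 \<otimes>\<^sub>H y = 0" "x \<otimes>\<^sub>H 0 = 0"
  using htensor_add_left[of 0 0 y] htensor_add_right[of x 0 0] by simp_all

lemma htensor_sum_left: "(\<Sum>e\<in>E. f e) \<otimes>\<^sub>H y = (\<Sum>e\<in>E. f e \<otimes>\<^sub>H y)"
  by (induction E rule: infinite_finite_induct) (auto simp: htensor_add_left htensor_zero)

lemma norm_tensor_sum_swap:
  "norm (tensor_sum (map prod.swap us)) = norm (tensor_sum us)"
proof -
  have *: "cinner (x \<otimes>\<^sub>H y) (tensor_sum vs) = cinner (y \<otimes>\<^sub>H x) (tensor_sum (map prod.swap vs))"
    for x :: 'a and y :: 'b and vs
    by (induction vs) (auto simp: cinner_add_right)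
  have "cinner (tensor_sum (map prod.swap us)) (tensor_sum (map prod.swap vs))
      = cinner (tensor_sum us) (tensor_sum vs)" for vs
    by (induction us) (auto simp: cinner_add_left *)
  then show ?thesis by (simp add: norm_eq_sqrt_cinner)
qed

text \<open>
  Expanding the first factors in an orthonormal set \<open>E\<close> turns \<open>\<Sum> x\<^sub>i \<otimes> y\<^sub>i\<close> into \<open>\<Sum>\<^bsub>e\<^esub> e \<otimes> w\<^sub>e\<close>, whose
  squared norm is \<open>\<Sum>\<^bsub>e\<^esub> \<parallel>w\<^sub>e\<parallel>\<^sup>2\<close>. The map \<open>1 \<otimes> B\<close> only replaces each \<open>w\<^sub>e\<close> by \<open>B w\<^sub>e\<close>.
\<close>

lemma norm_tensor_sum_map_right:
  fixes us :: "('a::complex_inner \<times> 'b::complex_inner) list" and B :: "'b \<Rightarrow> 'c::complex_inner"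
  assumes B: "bounded_clinear B"
  shows "norm (tensor_sum (map (apsnd B) us)) \<le> onorm B * norm (tensor_sum us)"
proof -
  obtain E where E: "finite E" "\<And>e f. e \<in> E \<Longrightarrow> f \<in> E \<Longrightarrow> cinner e f = (if e = f then 1 else 0)"
    and X: "\<And>x. x \<in> fst ` set us \<Longrightarrow> x = (\<Sum>e\<in>E. cinner x e *\<^sub>C e)"
    using finite_orthonormal_expansion[of "fst ` set us"] by auto
  define w where "w vs e = (\<Sum>(x, y)\<leftarrow>vs. cinner x e *\<^sub>C y)" for vs :: "('a \<times> 'b) list" and e
  have expand: "tensor_sum (map (apsnd C) vs) = (\<Sum>e\<in>E. e \<otimes>\<^sub>H C (w vs e))"
    if C: "bounded_clinear C" and "set vs \<subseteq> set us" for C :: "'b \<Rightarrow> 'd::complex_inner" and vs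
    using that(2)
  proof (induction vs)
    case Nil
    then show ?case by (simp add: w_def bounded_clinear_simps[OF C] htensor_zero)
  next
    case (Cons u vs)
    obtain x y where u: "u = (x, y)" by (cases u)
    then have "x \<in> fst ` set us" using Cons.prems by force
    then have "x \<otimes>\<^sub>H C y = (\<Sum>e\<in>E. cinner x e *\<^sub>C e) \<otimes>\<^sub>H C y" using X by simp
    also have "\<dots> = (\<Sum>e\<in>E. e \<otimes>\<^sub>H C (cinner x e *\<^sub>C y))"
      by (simp add: htensor_sum_left htensor_scaleC_left htensor_scaleC_right bounded_clinear_simps[OF C])
    finally show ?case using Cons
      by (simp add: u w_def bounded_clinear_simps[OF C] htensor_add_right sum.distrib)
  qed
  have norm: "(norm (\<Sum>e\<in>E. e \<otimes>\<^sub>H v e))\<^sup>2 = (\<Sum>e\<in>E. (norm (v e))\<^sup>2)" for v :: "'a \<Rightarrow> 'd::complex_inner"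
  proof -
    have "cinner (\<Sum>e\<in>E. e \<otimes>\<^sub>H v e) (\<Sum>e\<in>E. e \<otimes>\<^sub>H v e)
        = (\<Sum>e\<in>E. \<Sum>f\<in>E. if f = e then cinner (v e) (v f) else 0)"
      unfolding cinner_sum_left cinner_sum_right by (intro sum.cong) (auto simp: E)
    also have "\<dots> = (\<Sum>e\<in>E. cinner (v e) (v e))" using E(1) by simp
    finally have "complex_of_real ((norm (\<Sum>e\<in>E. e \<otimes>\<^sub>H v e))\<^sup>2) = complex_of_real (\<Sum>e\<in>E. (norm (v e))\<^sup>2)"
      by (simp only: cinner_self of_real_sum)
    then show ?thesis by (simp only: of_real_eq_iff)
  qed
  have id: "bounded_clinear (\<lambda>y::'b. y)" by (simp add: bounded_clinear_def bounded_linear_ident)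
  have us: "tensor_sum us = (\<Sum>e\<in>E. e \<otimes>\<^sub>H w us e)"
    using expand[OF id, of us] map_idI[of us "apsnd (\<lambda>y. y)"] by auto
  have bl: "bounded_linear B" by (rule bounded_clinear_simps[OF B])
  have "(norm (tensor_sum (map (apsnd B) us)))\<^sup>2 = (\<Sum>e\<in>E. (norm (B (w us e)))\<^sup>2)"
    using expand[OF B, of us] norm by simp
  also have "\<dots> \<le> (\<Sum>e\<in>E. (onorm B * norm (w us e))\<^sup>2)"
    by (intro sum_mono power_mono onorm[OF bl]) simp
  also have "\<dots> = (onorm B * norm (tensor_sum us))\<^sup>2"
    by (simp add: us norm power_mult_distrib sum_distrib_left)
  finally show ?thesis
    by (rule power2_le_imp_le) (simp add: onorm_pos_le[OF bl])
qed

text \<open>The flip \<open>x \<otimes> y \<mapsto> y \<otimes> x\<close> is isometric and exchanges \<open>A \<otimes> 1\<close> with \<open>1 \<otimes> A\<close>.\<close>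

lemma norm_tensor_sum_map_left:
  assumes A: "bounded_clinear A"
  shows "norm (tensor_sum (map (apfst A) us)) \<le> onorm A * norm (tensor_sum us)"
proof -
  have "map (apfst A) us = map prod.swap (map (apsnd A) (map prod.swap us))" by auto
  then have "norm (tensor_sum (map (apfst A) us)) = norm (tensor_sum (map (apsnd A) (map prod.swap us)))"
    by (simp only: norm_tensor_sum_swap)
  also have "\<dots> \<le> onorm A * norm (tensor_sum (map prod.swap us))"
    by (rule norm_tensor_sum_map_right[OF A])
  finally show ?thesis by (simp only: norm_tensor_sum_swap)
qed

lemma bounded_clinear_eq_if_eq_on_pure:
  fixes W W' :: "('a::complex_hilbert_space, 'b::complex_hilbert_space) htensor \<Rightarrow> 'c::complex_inner"
  assumes W: "bounded_clinear W" and W': "bounded_clinear W'"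
    and eq: "\<And>x y. W (x \<otimes>\<^sub>H y) = W' (x \<otimes>\<^sub>H y)"
  shows "W = W'"
proof -
  have "closed {z. W z = W' z}"
    by (intro closed_Collect_eq linear_continuous_on bounded_clinear_simps[OF W] bounded_clinear_simps[OF W'])
  moreover have "range tensor_sum \<subseteq> {z. W z = W' z}"
    by (auto simp: bounded_clinear_tensor_sum[OF W] bounded_clinear_tensor_sum[OF W'] eq)
  ultimately have "closure (range tensor_sum) \<subseteq> {z. W z = W' z}"
    by (intro closure_minimal)
  then show ?thesis by (auto simp: closure_range_tensor_sum)
qed

text \<open>
  The factorisation \<open>A \<otimes> B = (A \<otimes> 1) (1 \<otimes> B)\<close> bounds the norm on finite sums by \<open>\<parallel>A\<parallel> \<parallel>B\<parallel>\<close>. This also shows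
  that the image of a tensor does not depend on how it is written as a sum.
\<close>

lemma tensor_op:
  fixes A :: "'a::complex_hilbert_space \<Rightarrow> 'c::complex_hilbert_space"
    and B :: "'b::complex_hilbert_space \<Rightarrow> 'd::complex_hilbert_space"
  assumes A: "bounded_clinear A" and B: "bounded_clinear B"
  shows bounded_clinear_tensor_op: "bounded_clinear (A \<otimes>\<^sub>o B)"
    and tensor_op_htensor: "(A \<otimes>\<^sub>o B) (x \<otimes>\<^sub>H y) = A x \<otimes>\<^sub>H B y"
proof -
  define \<Gamma> where "\<Gamma> = range (\<lambda>us. (tensor_sum us, tensor_sum (map (map_prod A B) us)))"
  have "\<exists>W. bounded_clinear W \<and> (\<forall>p\<in>\<Gamma>. W (fst p) = snd p)"
  proof (rule dense_graph_extension[where K = "onorm A * onorm B"])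
    fix p assume "p \<in> \<Gamma>"
    then obtain us where p: "p = (tensor_sum us, tensor_sum (map (map_prod A B) us))"
      by (auto simp: \<Gamma>_def)
    {
      fix q assume "q \<in> \<Gamma>"
      then obtain vs where "q = (tensor_sum vs, tensor_sum (map (map_prod A B) vs))"
        by (auto simp: \<Gamma>_def)
      then have "(fst p + fst q, snd p + snd q)
          = (tensor_sum (us @ vs), tensor_sum (map (map_prod A B) (us @ vs)))"
        by (simp add: p)
      then show "(fst p + fst q, snd p + snd q) \<in> \<Gamma>" unfolding \<Gamma>_def by blast
    }
    {
      fix c
      have "map (apfst ((*\<^sub>C) c)) (map (map_prod A B) us) = map (map_prod A B) (map (apfst ((*\<^sub>C) c)) us)"
        by (auto simp: bounded_clinear_simps[OF A])
      then have "(c *\<^sub>C fst p, c *\<^sub>C snd p) = (\<lambda>us. (tensor_sum us, tensor_sum (map (map_prod A B) us)))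
          (map (apfst ((*\<^sub>C) c)) us)"
        by (simp only: p fst_conv snd_conv scaleC_tensor_sum)
      then show "(c *\<^sub>C fst p, c *\<^sub>C snd p) \<in> \<Gamma>" unfolding \<Gamma>_def by blast
    }
    have "map (map_prod A B) us = map (apfst A) (map (apsnd B) us)" by auto
    then have "norm (snd p) \<le> onorm A * norm (tensor_sum (map (apsnd B) us))"
      using norm_tensor_sum_map_left[OF A] by (simp only: p snd_conv)
    also have "\<dots> \<le> onorm A * (onorm B * norm (tensor_sum us))"
      by (intro mult_left_mono norm_tensor_sum_map_right[OF B] onorm_pos_le bounded_clinear_simps[OF A])
    finally show "norm (snd p) \<le> onorm A * onorm B * norm (fst p)" by (simp add: p)
  next
    have "fst ` \<Gamma> = range tensor_sum" by (auto simp: \<Gamma>_def image_image)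
    then show "closure (fst ` \<Gamma>) = UNIV" by (simp add: closure_range_tensor_sum)
  qed
  then obtain W where W: "bounded_clinear W" and graph: "\<And>p. p \<in> \<Gamma> \<Longrightarrow> W (fst p) = snd p" by blast
  have pure: "W (x \<otimes>\<^sub>H y) = A x \<otimes>\<^sub>H B y" for x y
  proof -
    have "(x \<otimes>\<^sub>H y, A x \<otimes>\<^sub>H B y) = (\<lambda>us. (tensor_sum us, tensor_sum (map (map_prod A B) us))) [(x, y)]"
      by simp
    then have "(x \<otimes>\<^sub>H y, A x \<otimes>\<^sub>H B y) \<in> \<Gamma>" unfolding \<Gamma>_def by blast
    from graph[OF this] show ?thesis by simp
  qed
  have "(A \<otimes>\<^sub>o B) = W"
    unfolding tensor_op_def using W pure
    by (intro the_equality) (auto intro!: bounded_clinear_eq_if_eq_on_pure)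
  then show "bounded_clinear (A \<otimes>\<^sub>o B)" "(A \<otimes>\<^sub>o B) (x \<otimes>\<^sub>H y) = A x \<otimes>\<^sub>H B y"
    using W pure by simp_all
qed

lemma isometry_opI_pure:
  fixes V :: "('a::complex_hilbert_space, 'b::complex_hilbert_space) htensor \<Rightarrow> 'c::complex_hilbert_space"
  assumes V: "bounded_clinear V"
    and pure: "\<And>x y x' y'. cinner (V (x \<otimes>\<^sub>H y)) (V (x' \<otimes>\<^sub>H y')) = cinner x x' * cinner y y'"
  shows "isometry_op V"
proof -
  have 1: "cinner (V (x \<otimes>\<^sub>H y)) (V (tensor_sum vs)) = cinner (x \<otimes>\<^sub>H y) (tensor_sum vs)" for x y vs
    by (induction vs) (auto simp: bounded_clinear_simps[OF V] cinner_add_right pure)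
  have "cinner (V (tensor_sum us)) (V (tensor_sum vs)) = cinner (tensor_sum us) (tensor_sum vs)" for us vs
    by (induction us) (auto simp: bounded_clinear_simps[OF V] cinner_add_left 1)
  then have "range tensor_sum \<subseteq> {z. norm (V z) = norm z}"
    by (auto simp: norm_eq_sqrt_cinner)
  moreover have "closed {z. norm (V z) = norm z}"
    by (intro closed_Collect_eq continuous_intros linear_continuous_on bounded_clinear_simps[OF V])
  ultimately have "closure (range tensor_sum) \<subseteq> {z. norm (V z) = norm z}"
    by (intro closure_minimal)
  then show ?thesis using V by (auto simp: closure_range_tensor_sum isometry_op_def)
qed


section \<open>Quantum annulus unitaries\<close>

text \<open>
  These are \<open>J\<^sup>*K = I = K\<^sup>*J\<close> and \<open>J\<^sup>*J + K\<^sup>*K = q\<close> as identities of forms, where \<open>K = J\<^sup>-\<^sup>*\<close>. The last one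
  holds because \<open>K\<^sup>*K = J\<^sup>-\<^sup>1J\<^sup>-\<^sup>*\<close> is the inverse of \<open>J\<^sup>*J\<close>.
\<close>

lemma
  fixes J :: "'h::complex_hilbert_space \<Rightarrow> 'h"
  assumes J: "quantum_annulus_unitary r J"
  shows quantum_annulus_bounded: "bounded_clinear J" "bounded_clinear (inv J)"
      "bounded_clinear (cadjoint (inv J))"
    and cinner_J_inv_adjoint: "cinner (J y) (cadjoint (inv J) z) = cinner y z"
      "cinner (cadjoint (inv J) y) (J z) = cinner y z"
    and quantum_annulus_form: "cinner (J y) (J z) + cinner (cadjoint (inv J) y) (cadjoint (inv J) z)
      = of_real (r\<^sup>2 + 1 / r\<^sup>2) * cinner y z"
proof -
  let ?K = "cadjoint (inv J)" and ?T = "cadjoint J \<circ> J"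
  have b: "bounded_clinear J" "bounded_clinear (inv J)" and "bij J"
    using J by (auto simp: quantum_annulus_unitary_def invertible_op_def)
  have inv: "inv J (J x) = x" "J (inv J x) = x" for x
    using \<open>bij J\<close> by (simp_all add: bij_is_inj bij_is_surj surj_f_inv_f)
  show "bounded_clinear J" "bounded_clinear (inv J)" "bounded_clinear ?K"
    using b bounded_clinear_cadjoint by auto
  show JK: "cinner (J y) (?K z) = cinner y z" for y z
    by (simp add: cinner_cadjoint_right[OF b(2)] inv)
  show KJ: "cinner (?K y) (J z) = cinner y z" for y z
    by (simp add: cinner_cadjoint_left[OF b(2)] inv)
  have "inv ?T x = inv J (?K x)" for x
  proof (rule inv_f_eq)
    show "?T (inv J (?K x)) = x"
      by (rule cinner_ext) (simp add: inv cinner_cadjoint_right[OF b(1)] JK)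
    show "inj ?T"
    proof (rule injI)
      fix x y assume "?T x = ?T y"
      then have "cinner (?T x) (inv J (?K z)) = cinner (?T y) (inv J (?K z))" for z by simp
      then have "cinner (J x) (?K z) = cinner (J y) (?K z)" for z
        by (simp add: cinner_cadjoint_left[OF b(1)] inv)
      then have "cinner x z = cinner y z" for z by (simp add: JK)
      then show "x = y" by (metis cinner_commute cinner_ext)
    qed
  qed
  then have T: "cadjoint J (J y) + inv J (?K y) = (r\<^sup>2 + 1 / r\<^sup>2) *\<^sub>R y" for y
    using J by (simp add: quantum_annulus_unitary_def algebra_simps)
  have "cinner (J y) (J z) + cinner (?K y) (?K z) = cinner (cadjoint J (J y) + inv J (?K y)) z"
    by (simp add: cinner_add_left cinner_cadjoint_left[OF b(1)] cinner_cadjoint_right[OF b(2)])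
  then show "cinner (J y) (J z) + cinner (?K y) (?K z) = of_real (r\<^sup>2 + 1 / r\<^sup>2) * cinner y z"
    by (simp only: T cinner_scaleR_left)
qed

text \<open>
  With \<open>T = J\<^sup>*J\<close>, multiplying \<open>T + T\<^sup>-\<^sup>1 = l + 1/l\<close> by \<open>T\<close> gives \<open>(T - l) (T - 1/l) = 0\<close>, so every nonzero
  vector in the range of \<open>l T - 1\<close> is an eigenvector of \<open>T\<close> for \<open>l\<close>. The inequality assumed for \<open>x\<close> says
  that \<open>\<langle>(l T - 1) x, x\<rangle>\<close> is nonzero, hence so is \<open>(l T - 1) x\<close>. The parameter \<open>l\<close> serves for both roots,
  \<open>r\<^sup>2\<close> and \<open>r\<^sup>-\<^sup>2\<close>. A unit eigenvector \<open>h\<close> enters later arguments only through \<open>\<parallel>J h\<parallel>\<close> and \<open>\<parallel>J\<^sup>-\<^sup>* h\<parallel>\<close>.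
\<close>

lemma quantum_annulus_eigenvector:
  fixes J :: "'h::complex_hilbert_space \<Rightarrow> 'h"
  assumes J: "quantum_annulus_unitary r J"
    and l: "l > 0" "l + 1 / l = r\<^sup>2 + 1 / r\<^sup>2"
    and ne: "l * (norm (J x))\<^sup>2 \<noteq> (norm x)\<^sup>2"
  shows "\<exists>h. norm h = 1 \<and> (norm (J h))\<^sup>2 = l \<and> (norm (cadjoint (inv J) h))\<^sup>2 = 1 / l"
proof -
  let ?K = "cadjoint (inv J)" and ?T = "\<lambda>x. cadjoint J (J x)"
  note b = quantum_annulus_bounded[OF J]
  note bT = bounded_clinear_cadjoint[OF b(1)]
  have T2: "?T (?T y) + y = (l + 1 / l) *\<^sub>R ?T y" for y
  proof (rule cinner_ext)
    fix z
    \<comment> \<open>Since \<open>J\<^sup>-\<^sup>* u = J z\<close> for \<open>u = T z\<close>, the form identity at \<open>(u, y)\<close> is the claim paired with \<open>z\<close>.\<close>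
    define u where "u = ?T z"
    have K: "?K u = J z"
    proof (rule cinner_ext)
      fix v
      have "cinner v (?K u) = cinner (J (inv J v)) (J z)"
        by (simp add: u_def cinner_cadjoint_right[OF b(2)] cinner_cadjoint_right[OF b(1)])
      also have "J (inv J v) = v"
        using J by (simp add: quantum_annulus_unitary_def invertible_op_def bij_is_surj surj_f_inv_f)
      finally show "cinner v (?K u) = cinner v (J z)" .
    qed
    have "cinner (J u) (J y) + cinner (?K u) (?K y) = of_real (l + 1 / l) * cinner u y"
      using quantum_annulus_form[OF J, of u y] l(2) by simp
    moreover have "cinner (J u) (J y) = cinner z (?T (?T y))"
      unfolding u_def by (metis cinner_cadjoint_left cinner_cadjoint_right b(1))
    moreover have "cinner u y = cinner z (?T y)"
      by (simp add: u_def cinner_cadjoint_left[OF b(1)] cinner_cadjoint_right[OF b(1)])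
    ultimately show "cinner z (?T (?T y) + y) = cinner z ((l + 1 / l) *\<^sub>R ?T y)"
      by (simp add: K cinner_J_inv_adjoint[OF J] cinner_add_right)
  qed
  define g where "g = l *\<^sub>R ?T x - x"
  have "cinner g x = of_real (l * (norm (J x))\<^sup>2 - (norm x)\<^sup>2)"
    by (simp add: g_def cinner_diff_left cinner_cadjoint_left[OF b(1)] cinner_self)
  then have g0: "g \<noteq> 0" using ne by (metis cinner_zero_left eq_iff_diff_eq_0 of_real_eq_0_iff)
  have "?T g = l *\<^sub>R ?T (?T x) - ?T x"
    by (simp add: g_def bounded_clinear_simps[OF b(1)] bounded_clinear_simps[OF bT])
  also have "?T (?T x) = (l + 1 / l) *\<^sub>R ?T x - x" using T2[of x] by (simp add: eq_diff_eq)
  also have "l *\<^sub>R ((l + 1 / l) *\<^sub>R ?T x - x) - ?T x = l *\<^sub>R g"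
    using l(1) by (simp add: g_def scaleR_diff_right scaleR_add_left scaleR_add_right distrib_left)
  finally have Tg: "?T g = l *\<^sub>R g" .
  define h where "h = inverse (norm g) *\<^sub>R g"
  have nh: "norm h = 1" using g0 by (simp add: h_def)
  have "?T h = l *\<^sub>R h"
    by (simp add: h_def bounded_clinear_simps[OF b(1)] bounded_clinear_simps[OF bT] Tg)
  then have "cinner (J h) (J h) = of_real l"
    using cinner_cadjoint_right[OF b(1), of h "J h"] nh by (simp add: cinner_self)
  then have 1: "(norm (J h))\<^sup>2 = l"
    by (simp only: cinner_self of_real_eq_iff)
  have "complex_of_real ((norm (J h))\<^sup>2 + (norm (?K h))\<^sup>2) = of_real (l + 1 / l)"
    using quantum_annulus_form[OF J, of h h] nh l(2) by (simp only: cinner_self of_real_add) simp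
  then have "(norm (J h))\<^sup>2 + (norm (?K h))\<^sup>2 = l + 1 / l"
    by (simp only: of_real_eq_iff)
  then show ?thesis using nh 1 by auto
qed


section \<open>Isometries built from a quantum annulus unitary\<close>

theorem proposition2p3:
  fixes r :: real
    and J :: "'h::complex_hilbert_space \<Rightarrow> 'h"
    and A B :: "'l::complex_hilbert_space \<Rightarrow> 'l"
  assumes "r > 1"
    and "quantum_annulus_unitary r J"
    and "onorm J = r" and "onorm (inv J) = r"
    and "bounded_clinear A" and "bounded_clinear B"
  shows "isometry_op (\<lambda>z. (A \<otimes>\<^sub>o J) z + (B \<otimes>\<^sub>o cadjoint (inv J)) z) \<longleftrightarrow>
    cadjoint A \<circ> A = cadjoint B \<circ> B \<and>
    (\<forall>x. cadjoint A (B x) + cadjoint B (A x) + (r\<^sup>2 + 1 / r\<^sup>2) *\<^sub>R cadjoint A (A x) = x)"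
    (is "isometry_op ?V \<longleftrightarrow> ?eq \<and> (\<forall>x. ?S x = x)")
proof -
  let ?K = "cadjoint (inv J)" and ?q = "r\<^sup>2 + 1 / r\<^sup>2"
  note r = assms(1) and J = assms(2) and A = assms(5) and B = assms(6)
  note bJ = quantum_annulus_bounded[OF J]
  note bA = bounded_clinear_cadjoint[OF A] and bB = bounded_clinear_cadjoint[OF B]
  have V: "bounded_clinear ?V"
    by (intro bounded_clinear_add bounded_clinear_tensor_op A B bJ)
  have pure: "?V (x \<otimes>\<^sub>H y) = A x \<otimes>\<^sub>H J y + B x \<otimes>\<^sub>H ?K y" for x y
    by (simp add: tensor_op_htensor A B bJ)
  have form: "cinner (?V (x \<otimes>\<^sub>H y)) (?V (x' \<otimes>\<^sub>H y')) = cinner (A x) (A x') * cinner (J y) (J y')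
      + (cinner (A x) (B x') + cinner (B x) (A x')) * cinner y y'
      + cinner (B x) (B x') * cinner (?K y) (?K y')" for x y x' y'
    unfolding pure by (simp add: cinner_add_left cinner_add_right cinner_J_inv_adjoint[OF J] algebra_simps)
  show ?thesis
  proof
    assume eqs: "?eq \<and> (\<forall>x. ?S x = x)"
    then have "cadjoint A (A x) = cadjoint B (B x)" for x by (metis comp_apply)
    then have AB: "cinner (B x) (B x') = cinner (A x) (A x')" for x x'
      by (metis cinner_cadjoint_left A B)
    have S: "cinner (A x) (B x') + cinner (B x) (A x') + of_real ?q * cinner (A x) (A x') = cinner x x'"
      for x x'
    proof -
      have "cinner x (?S x') = cinner x x'" using eqs by simp
      then show ?thesis
        by (simp add: cinner_add_right cinner_cadjoint_right[OF A] cinner_cadjoint_right[OF B])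
    qed
    show "isometry_op ?V"
    proof (rule isometry_opI_pure[OF V])
      fix x y x' y'
      have "cinner (?V (x \<otimes>\<^sub>H y)) (?V (x' \<otimes>\<^sub>H y'))
          = cinner (A x) (A x') * (cinner (J y) (J y') + cinner (?K y) (?K y'))
            + (cinner (A x) (B x') + cinner (B x) (A x')) * cinner y y'"
        unfolding form AB by (simp add: algebra_simps)
      also have "\<dots> = (cinner (A x) (B x') + cinner (B x) (A x') + of_real ?q * cinner (A x) (A x')) * cinner y y'"
        unfolding quantum_annulus_form[OF J] by (simp add: algebra_simps)
      finally show "cinner (?V (x \<otimes>\<^sub>H y)) (?V (x' \<otimes>\<^sub>H y')) = cinner x x' * cinner y y'"
        by (simp only: S)
    qed
  next
    assume iso: "isometry_op ?V"
    have quad: "l * (norm (A x))\<^sup>2 + 2 * Re (cinner (A x) (B x)) + (norm (B x))\<^sup>2 / l = (norm x)\<^sup>2"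
      if h: "norm h = 1" "(norm (J h))\<^sup>2 = l" "(norm (?K h))\<^sup>2 = 1 / l" for h l x
    proof -
      have "(norm x)\<^sup>2 = Re (cinner (x \<otimes>\<^sub>H h) (x \<otimes>\<^sub>H h))"
        unfolding cinner_htensor by (simp only: cinner_self h) simp
      also have "\<dots> = Re (cinner (?V (x \<otimes>\<^sub>H h)) (?V (x \<otimes>\<^sub>H h)))"
        using iso by (simp only: cinner_self isometry_op_def)
      also have "\<dots> = Re (of_real ((norm (A x))\<^sup>2) * of_real l + (cinner (A x) (B x) + cinner (B x) (A x)) * of_real (1\<^sup>2)
          + of_real ((norm (B x))\<^sup>2) * of_real (1 / l))"
        unfolding form by (simp only: cinner_self h)
      also have "\<dots> = l * (norm (A x))\<^sup>2 + 2 * Re (cinner (A x) (B x)) + (norm (B x))\<^sup>2 / l"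
      proof -
        have "Re (cinner (B x) (A x)) = Re (cinner (A x) (B x))"
          using cinner_commute[of "A x" "B x"] by simp
        then show ?thesis
          by (simp only: plus_complex.sel of_real_mult[symmetric] Re_complex_of_real power_one of_real_1
              mult_1_right)
             (simp add: mult.commute)
      qed
      finally show ?thesis by simp
    qed
    have r2: "r\<^sup>2 > 1" using r by (simp add: one_less_power)
    \<comment> \<open>Otherwise \<open>J\<close> would be \<open>1/r\<close> times an isometry, too small for norm \<open>r\<close>.\<close>
    have "\<exists>x. r\<^sup>2 * (norm (J x))\<^sup>2 \<noteq> (norm x)\<^sup>2"
    proof (rule ccontr)
      assume "\<not> ?thesis"
      then have "(r * norm (J x))\<^sup>2 = (norm x)\<^sup>2" for x by (simp add: power_mult_distrib)
      then have "r * norm (J x) = norm x" for x using r by simp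
      then have "onorm J \<le> 1 / r"
        using r by (intro onorm_bound) (simp_all add: field_simps)
      then show False using assms(3) r r2 by (simp add: field_simps power2_eq_square)
    qed
    then obtain x where "r\<^sup>2 * (norm (J x))\<^sup>2 \<noteq> (norm x)\<^sup>2" by blast
    then obtain h where h: "norm h = 1" "(norm (J h))\<^sup>2 = r\<^sup>2" "(norm (?K h))\<^sup>2 = 1 / r\<^sup>2"
      using quantum_annulus_eigenvector[OF J, of "r\<^sup>2" x] r by auto
    \<comment> \<open>Otherwise \<open>J\<^sup>-\<^sup>1\<close> would be \<open>1/r\<close> times an isometry.\<close>
    have "\<exists>x. (1 / r\<^sup>2) * (norm (J x))\<^sup>2 \<noteq> (norm x)\<^sup>2"
    proof (rule ccontr)
      assume "\<not> ?thesis"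
      then have "(norm (J x))\<^sup>2 = (r * norm x)\<^sup>2" for x using r by (simp add: field_simps)
      then have "norm (J x) = r * norm x" for x using r by simp
      moreover have "J (inv J x) = x" for x
        using J by (simp add: quantum_annulus_unitary_def invertible_op_def bij_is_surj surj_f_inv_f)
      ultimately have "norm x = r * norm (inv J x)" for x by metis
      then have "norm (inv J x) \<le> 1 / r * norm x" for x
        using r by (metis eq_refl less_trans nonzero_mult_div_cancel_left order_less_irrefl times_divide_eq_left
            mult_1 zero_less_one)
      then have "onorm (inv J) \<le> 1 / r"
        using r by (intro onorm_bound) simp_all
      then show False using assms(4) r r2 by (simp add: field_simps power2_eq_square)
    qed
    then obtain x where "(1 / r\<^sup>2) * (norm (J x))\<^sup>2 \<noteq> (norm x)\<^sup>2" by blast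
    then obtain k where k: "norm k = 1" "(norm (J k))\<^sup>2 = 1 / r\<^sup>2" "(norm (?K k))\<^sup>2 = 1 / (1 / r\<^sup>2)"
      using quantum_annulus_eigenvector[OF J, of "1 / r\<^sup>2" x] r by auto
    have norms: "(norm (B x))\<^sup>2 = (norm (A x))\<^sup>2" for x
    proof -
      have "(r\<^sup>2 - 1 / r\<^sup>2) * ((norm (A x))\<^sup>2 - (norm (B x))\<^sup>2) = 0"
        using quad[OF h, of x] quad[OF k, of x] by (simp add: algebra_simps)
      moreover have "1 / r\<^sup>2 < 1" using r2 by (subst divide_less_eq_1_pos) linarith+
      then have "r\<^sup>2 - 1 / r\<^sup>2 \<noteq> 0" using r2 by linarith
      ultimately show ?thesis by simp
    qed
    note lin = bounded_clinear_simps(2,4)[OF A] bounded_clinear_simps(2,4)[OF B]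
      bounded_clinear_simps(2,4)[OF bA] bounded_clinear_simps(2,4)[OF bB]
    have "cadjoint A (A x) - cadjoint B (B x) = 0" for x
    proof (rule clinear_eq_0_if_form_eq_0[of "\<lambda>x. cadjoint A (A x) - cadjoint B (B x)"])
      show "cinner (cadjoint A (A x) - cadjoint B (B x)) x = 0" for x
        by (simp only: cinner_diff_left cinner_cadjoint_left[OF A] cinner_cadjoint_left[OF B]
            cinner_self norms) simp
    qed (simp_all add: lin scaleC_diff_right)
    then have "?eq" by (auto simp: fun_eq_iff)
    moreover have "?S x - x = 0" for x
    proof (rule clinear_eq_0_if_form_eq_0[of "\<lambda>x. ?S x - x"])
      show "cinner (?S x - x) x = 0" for x
      proof -
        have "cinner (?S x - x) x = cinner (B x) (A x) + cnj (cinner (B x) (A x))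
            + of_real (?q * (norm (A x))\<^sup>2 - (norm x)\<^sup>2)"
          using cinner_commute[of "A x" "B x"]
          by (simp add: cinner_diff_left cinner_add_left cinner_cadjoint_left[OF A]
              cinner_cadjoint_left[OF B] cinner_self)
        also have "\<dots> = of_real (2 * Re (cinner (A x) (B x)) + ?q * (norm (A x))\<^sup>2 - (norm x)\<^sup>2)"
          using cinner_commute[of "A x" "B x"] by (simp add: complex_add_cnj)
        also have "\<dots> = 0"
          using quad[OF h, of x] by (simp add: norms algebra_simps)
        finally show ?thesis .
      qed
      show "?S (x + y) - (x + y) = (?S x - x) + (?S y - y)" for x y
        by (simp add: lin scaleR_add_right)
      show "?S (c *\<^sub>C x) - c *\<^sub>C x = c *\<^sub>C (?S x - x)" for c x
        by (simp add: lin scaleR_scaleC scaleC_add_right scaleC_diff_right mult.commute)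
    qed
    ultimately show "?eq \<and> (\<forall>x. ?S x = x)" by simp
  qed
qed

end
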